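(* Assume that the sequence $(a_i)_{i\ge1}$ is bounded, that $\mathsf H(\mathbf a)=\sum_{i\ge1}\frac{a_i^2}{A_i}<\infty$ and that $A_n\ge n^{1-\alpha+o(1)}$ as $n\to\infty$ for some $\alpha\in(0,1)$. Then the Hausdorff dimension of the random tree $\mathcal T$ built by aggregation from $(a_i)_{i\ge1}$ is at least $\alpha^{-1}$ almost surely.
   Context: Let $\mathbf a=(a_i)_{i\ge 1}$ be a (deterministic) sequence of positive real numbers and $A_i=a_1+\dots+a_i$. The random trees $(\mathcal T_n)_{n\ge1}$ are built as follows: $\mathcal T_1$ is a closed segment of length $a_1$, rooted at one of its ends $\rho$; recursively, conditionally on $\mathcal T_1,\dots,\mathcal T_n$, pick a point of $\mathcal T_n$ uniformly (according to the length measure on $\mathcal T_n$ normalized to be a probability) and obtain $\mathcal T_{n+1}$ by gluing one end of a new closed segment ("branch") of length $a_{n+1}$ at this point. Concretely, $\mathcal T_1=\{(x,0,0,\dots):x\in[0,a_1]\}\subset\ell^1(\mathbb R)$ and $\mathcal T_{n+1}=\mathcal T_n\cup\{(u_1,\dots,u_n,x,0,0,\dots):x\in[0,a_{n+1}]\}$ where $(u_1,\dots,u_n,0,\dots)$ is the uniform point of $\mathcal T_n$. The tree $\mathcal T$ is the completion (closure in $\ell^1(\mathbb R)$) of the increasing union $\bigcup_n\mathcal T_n$, endowed with its length metric. Notation: $A_n\ge n^{1-\alpha+o(1)}$ means that for every $\varepsilon>0$, $A_n\ge n^{1-\alpha-\varepsilon}$ for all $n$ large enough. *)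

theory Defs
  imports "HOL-Probability.Probability"
begin

section \<open>The sequence space \<open>\<ell>\<^sup>1(\<real>)\<close>\<close>

typedef l1 = "{f :: nat \<Rightarrow> real. summable (\<lambda>k. \<bar>f k\<bar>)}"
  morphisms coord Abs_l1
  by (rule exI[of _ "\<lambda>_. 0"]) simp

setup_lifting type_definition_l1

lemma summable_coord: "summable (\<lambda>k. \<bar>coord f k\<bar>)"
  using coord[of f] by simp

instantiation l1 :: real_normed_vector
begin

lift_definition zero_l1 :: l1 is "\<lambda>_. 0"
  by simp

lift_definition plus_l1 :: "l1 \<Rightarrow> l1 \<Rightarrow> l1" is "\<lambda>f g k. f k + g k"
proof -
  fix f g :: "nat \<Rightarrow> real"
  assume "summable (\<lambda>k. \<bar>f k\<bar>)" "summable (\<lambda>k. \<bar>g k\<bar>)"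
  from summable_add[OF this] show "summable (\<lambda>k. \<bar>f k + g k\<bar>)"
    by (rule summable_comparison_test_ev[rotated]) (simp add: abs_triangle_ineq)
qed

lift_definition uminus_l1 :: "l1 \<Rightarrow> l1" is "\<lambda>f k. - f k"
  by simp

definition minus_l1 :: "l1 \<Rightarrow> l1 \<Rightarrow> l1" where
  "minus_l1 f g = f + - g"

lift_definition scaleR_l1 :: "real \<Rightarrow> l1 \<Rightarrow> l1" is "\<lambda>c f k. c * f k"
  by (simp add: abs_mult summable_mult)

definition norm_l1 :: "l1 \<Rightarrow> real" where
  "norm_l1 f = (\<Sum>k. \<bar>coord f k\<bar>)"

definition sgn_l1 :: "l1 \<Rightarrow> l1" where
  "sgn_l1 f = inverse (norm f) *\<^sub>R f"

definition dist_l1 :: "l1 \<Rightarrow> l1 \<Rightarrow> real" where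
  "dist_l1 f g = norm (f - g)"

definition uniformity_l1 :: "(l1 \<times> l1) filter" where
  "uniformity_l1 = (INF e\<in>{0<..}. principal {(x, y). dist x y < e})"

definition open_l1 :: "l1 set \<Rightarrow> bool" where
  "open_l1 S = (\<forall>x\<in>S. \<forall>\<^sub>F (x', y) in uniformity. x' = x \<longrightarrow> y \<in> S)"

instance
proof
  fix f g :: l1 and c d :: real
  show "f - g = f + - g" "dist f g = norm (f - g)" "sgn f = inverse (norm f) *\<^sub>R f"
    by (simp_all add: minus_l1_def dist_l1_def sgn_l1_def)
  show "(norm f = 0) = (f = 0)"
  proof
    assume "norm f = 0"
    then have "\<bar>coord f k\<bar> = 0" for k
      using suminf_eq_zero_iff[OF summable_coord[of f]] by (simp add: norm_l1_def)
    then show "f = 0"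
      by (intro coord_inject[THEN iffD1] ext) (simp add: zero_l1.rep_eq)
  qed (simp add: norm_l1_def zero_l1.rep_eq)
  have "norm (f + g) \<le> (\<Sum>k. \<bar>coord f k\<bar> + \<bar>coord g k\<bar>)"
    unfolding norm_l1_def
    by (intro suminf_le summable_coord summable_add) (simp add: plus_l1.rep_eq abs_triangle_ineq)
  then show "norm (f + g) \<le> norm f + norm g"
    by (simp add: norm_l1_def suminf_add summable_coord)
  show "norm (c *\<^sub>R f) = \<bar>c\<bar> * norm f"
    by (simp add: norm_l1_def scaleR_l1.rep_eq abs_mult suminf_mult summable_coord)
qed ((rule uniformity_l1_def open_l1_def | transfer, simp add: algebra_simps)+)

end

instance l1 :: banach
proof
  fix X :: "nat \<Rightarrow> l1"
  assume X: "Cauchy X"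
  define L where "L k = lim (\<lambda>n. coord (X n) k)" for k
  have partial: "(\<Sum>k<m. \<bar>coord f k\<bar>) \<le> norm f" for f m
    unfolding norm_l1_def by (rule sum_le_suminf[OF summable_coord]) auto
  have coord_diff: "coord (f - g) k = coord f k - coord g k" for f g k
    using plus_l1.rep_eq[of f "- g"] by (simp add: uminus_l1.rep_eq)
  have "Cauchy (\<lambda>n. coord (X n) k)" for k
  proof (rule metric_CauchyI)
    fix e :: real assume "0 < e"
    then obtain N where N: "\<And>m n. m \<ge> N \<Longrightarrow> n \<ge> N \<Longrightarrow> norm (X m - X n) < e"
      using X unfolding Cauchy_iff by blast
    have "\<bar>coord f k\<bar> \<le> norm f" for f
      using partial[of f "Suc k", unfolded sum.lessThan_Suc]
        sum_nonneg[of "{..<k}" "\<lambda>j. \<bar>coord f j\<bar>"] by linarith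
    then have "dist (coord (X m) k) (coord (X n) k) < e" if "m \<ge> N" "n \<ge> N" for m n
      using N[OF that] by (simp add: dist_real_def flip: coord_diff) (rule order_le_less_trans)
    then show "\<exists>M. \<forall>m\<ge>M. \<forall>n\<ge>M. dist (coord (X m) k) (coord (X n) k) < e"
      by blast
  qed
  then have L: "(\<lambda>n. coord (X n) k) \<longlonglongrightarrow> L k" for k
    by (simp add: L_def Cauchy_convergent_iff convergent_LIMSEQ_iff)
  have tail: "\<exists>N. \<forall>n\<ge>N. summable (\<lambda>k. \<bar>coord (X n) k - L k\<bar>) \<and>
      (\<Sum>k. \<bar>coord (X n) k - L k\<bar>) \<le> e" if "0 < e" for e
  proof -
    obtain N where N: "\<And>m n. m \<ge> N \<Longrightarrow> n \<ge> N \<Longrightarrow> norm (X m - X n) < e"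
      using X \<open>0 < e\<close> unfolding Cauchy_iff by blast
    have *: "(\<Sum>k<j. \<bar>coord (X n) k - L k\<bar>) \<le> e" if "n \<ge> N" for n j
    proof (rule tendsto_upperbound)
      show "(\<lambda>m. \<Sum>k<j. \<bar>coord (X n) k - coord (X m) k\<bar>)
          \<longlonglongrightarrow> (\<Sum>k<j. \<bar>coord (X n) k - L k\<bar>)"
        by (intro tendsto_intros L)
      show "\<forall>\<^sub>F m in sequentially. (\<Sum>k<j. \<bar>coord (X n) k - coord (X m) k\<bar>) \<le> e"
        using eventually_ge_at_top[of N]
      proof eventually_elim
        case (elim m)
        then show ?case
          using N[OF that elim] partial[of "X n - X m" j] by (simp add: coord_diff)
      qed
    qed simp
    show ?thesis
    proof (intro exI[of _ N] allI impI conjI)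
      fix n assume "N \<le> n"
      then show s: "summable (\<lambda>k. \<bar>coord (X n) k - L k\<bar>)"
        by (intro summableI_nonneg_bounded[where x = e] *) auto
      show "(\<Sum>k. \<bar>coord (X n) k - L k\<bar>) \<le> e"
        by (rule suminf_le_const[OF s *[OF \<open>N \<le> n\<close>]])
    qed
  qed
  obtain N where "summable (\<lambda>k. \<bar>coord (X N) k - L k\<bar>)"
    using tail[of 1] by auto
  then have "summable (\<lambda>k. \<bar>coord (X N) k\<bar> + \<bar>coord (X N) k - L k\<bar>)"
    by (intro summable_add summable_coord)
  then have "summable (\<lambda>k. \<bar>L k\<bar>)"
    by (rule summable_comparison_test_ev[rotated]) (intro always_eventually allI, simp)
  then have rep: "coord (Abs_l1 L) = L"
    by (simp add: Abs_l1_inverse)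
  have "X \<longlonglongrightarrow> Abs_l1 L"
  proof (rule metric_LIMSEQ_I)
    fix e :: real assume "0 < e"
    then obtain N where N: "\<And>n. n \<ge> N \<Longrightarrow> (\<Sum>k. \<bar>coord (X n) k - L k\<bar>) \<le> e / 2"
      using tail[of "e / 2"] by auto
    have "dist (X n) (Abs_l1 L) < e" if "n \<ge> N" for n
      using N[OF that] \<open>0 < e\<close> by (simp add: dist_l1_def norm_l1_def coord_diff rep)
    then show "\<exists>N. \<forall>n\<ge>N. dist (X n) (Abs_l1 L) < e"
      by blast
  qed
  then show "convergent X"
    by (rule convergentI)
qed

lift_definition unit_l1 :: "nat \<Rightarrow> l1" is "\<lambda>i k. if k = i then 1 else 0"
  by (rule summable_finite[of "{i}" for i]) auto


section \<open>Hausdorff dimension\<close>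

definition hausdorff_premeasure :: "real \<Rightarrow> real \<Rightarrow> 'a::metric_space set \<Rightarrow> ennreal" where
  "hausdorff_premeasure s \<delta> S =
     (INF E\<in>{E :: nat \<Rightarrow> 'a set. S \<subseteq> (\<Union>i. E i) \<and> (\<forall>i. bounded (E i) \<and> diameter (E i) \<le> \<delta>)}.
        \<Sum>i. ennreal (diameter (E i) powr s))"

definition hausdorff_measure :: "real \<Rightarrow> 'a::metric_space set \<Rightarrow> ennreal" where
  "hausdorff_measure s S = (SUP \<delta>\<in>{0<..}. hausdorff_premeasure s \<delta> S)"

(* Only s > 0 is used, so the convention 0 powr 0 = 0 plays no role; the infimum
   of the empty set is infinity. *)
definition hausdorff_dim :: "'a::metric_space set \<Rightarrow> ereal" where
  "hausdorff_dim S = Inf {ereal s | s. 0 < s \<and> hausdorff_measure s S = 0}"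


section \<open>Trees built by aggregation\<close>

(* Sequences a and u are indexed from 1 (the values a 0 and u 0 are never used), while
   the coordinates of l1 are indexed from 0: the branch of length a (Suc n), glued at u n,
   is parallel to the coordinate n.  Branch 0 is glued at the root 0. *)
definition branch :: "(nat \<Rightarrow> l1) \<Rightarrow> nat \<Rightarrow> real \<Rightarrow> l1" where
  "branch u n x = (if n = 0 then 0 else u n) + x *\<^sub>R unit_l1 n"

primrec finite_tree :: "(nat \<Rightarrow> real) \<Rightarrow> (nat \<Rightarrow> l1) \<Rightarrow> nat \<Rightarrow> l1 set" where
  "finite_tree a u 0 = {}"
| "finite_tree a u (Suc n) = finite_tree a u n \<union> branch u n ` {0..a (Suc n)}"

(* If every u n is a point of finite_tree a u n, then the path in the tree between two of its
   points is monotone in each coordinate, so that the length metric is the distance of l1. *)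
definition aggregation_tree :: "(nat \<Rightarrow> real) \<Rightarrow> (nat \<Rightarrow> l1) \<Rightarrow> l1 set" where
  "aggregation_tree a u = closure (\<Union>n. finite_tree a u n)"

(* The sum over the branches of the images of Lebesgue measure on [0, a (Suc i)]. *)
definition length_measure :: "(nat \<Rightarrow> real) \<Rightarrow> (nat \<Rightarrow> l1) \<Rightarrow> nat \<Rightarrow> l1 measure" where
  "length_measure a u n =
     distr (restrict_space (count_space UNIV \<Otimes>\<^sub>M lborel) (SIGMA i:{..<n}. {0..a (Suc i)}))
       borel (\<lambda>(i, x). branch u i x)"

definition uniform_on_tree :: "(nat \<Rightarrow> real) \<Rightarrow> (nat \<Rightarrow> l1) \<Rightarrow> nat \<Rightarrow> l1 measure" where
  "uniform_on_tree a u n = uniform_measure (length_measure a u n) (finite_tree a u n)"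

(* The sigma-algebra generated by the gluing points U 1, ..., U (n - 1), which carry the same
   information as the first n trees. *)
definition tree_history :: "'w measure \<Rightarrow> (nat \<Rightarrow> 'w \<Rightarrow> l1) \<Rightarrow> nat \<Rightarrow> 'w measure" where
  "tree_history M U n =
     vimage_algebra (space M) (\<lambda>\<omega>. \<lambda>i\<in>{1..<n}. U i \<omega>) (Pi\<^sub>M {1..<n} (\<lambda>_. borel))"

definition uniform_gluing :: "'w measure \<Rightarrow> (nat \<Rightarrow> real) \<Rightarrow> (nat \<Rightarrow> 'w \<Rightarrow> l1) \<Rightarrow> bool" where
  "uniform_gluing M a U \<longleftrightarrow>
     (\<forall>n\<ge>1. U n \<in> borel_measurable M) \<and>
     (\<forall>n\<ge>1. \<forall>B\<in>sets borel. AE \<omega> in M.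
        real_cond_exp M (tree_history M U n) (indicator (U n -` B \<inter> space M)) \<omega> =
        measure (uniform_on_tree a (\<lambda>i. U i \<omega>) n) B)"

definition partial_sum :: "(nat \<Rightarrow> real) \<Rightarrow> nat \<Rightarrow> real" where
  "partial_sum a n = (\<Sum>i=1..n. a i)"

end

theory Submission
  imports Defs
begin

text \<open>The bound comes from the energy of the uniform measures \<open>\<mu> n\<close> on the finite trees, at the scales that
  these trees resolve. Write \<open>A n\<close> for the length of the tree with \<open>n\<close> branches, and let two points be drawn
  independently from \<open>\<mu> n\<close>. Removing the last branch shows what the probability of \<open>r\<close>-close pairs gains in one step: pairs on the
  new branch contribute at most \<open>2 * r * a n\<close> to the product of the length measures, and a pair with one point on the new branch can be
  close only if this point lies within \<open>r\<close> of the gluing point and the other point is \<open>r\<close>-close to the gluing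
  point. As the gluing point is itself uniform, the last event has the same probability as a close pair on the
  old tree, so the expectations obey a closed recursive inequality (\<open>mean_close_pairs_Suc\<close>). Solving it up to the
  time \<open>k\<close> of order \<open>r powr (- 1 / p)\<close>, with \<open>p\<close> slightly larger than \<open>\<alpha>\<close>, and then letting the error telescope, gives
  a bound of order \<open>r / A k\<close>, hence \<open>r powr (1 / p)\<close>, that is uniform in the later trees
  (\<open>close_pairs_power_bound\<close>).

  The limit tree need not be compact, as infinitely many branches may have lengths bounded from below. But the mean distance of a
  \<open>\<mu> n\<close>-distributed point to the tree with \<open>k\<close> branches, which is the norm of its coordinates from \<open>k\<close> on, is at most
  the tail after \<open>k\<close> of \<open>\<Sum>i. (a i)\<^sup>2 / A i\<close> (\<open>mean_tail_norm_le\<close>). So one deterministic compact set carries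
  most of the mass of all \<open>\<mu> n\<close> on average (\<open>mean_outside_compact\<close>).

  No limit of the measures \<open>\<mu> n\<close> has to be constructed. By Fatou's lemma, with probability close to one there are infinitely
  many \<open>n\<close> for which \<open>\<mu> n\<close> charges the compact set and has bounded \<open>s\<close>-energy at the resolved scales. A
  countable cover with small \<open>s\<close>-dimensional sum reduces by compactness to a finite one, all of whose scales are resolved by such
  a \<open>\<mu> n\<close>, and the Cauchy-Schwarz inequality contradicts the energy bound (\<open>hausdorff_measure_neq_0\<close>).\<close>

section \<open>Coordinates, truncation and compact sets in the sequence space\<close>

lemma coord_zero [simp]: "coord 0 k = 0"
  by (simp add: zero_l1.rep_eq)

lemma coord_add [simp]: "coord (f + g) k = coord f k + coord g k"
  by (simp add: plus_l1.rep_eq)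

lemma coord_scaleR [simp]: "coord (c *\<^sub>R f) k = c * coord f k"
  by (simp add: scaleR_l1.rep_eq)

lemma coord_diff [simp]: "coord (f - g) k = coord f k - coord g k"
  using coord_add[of f "- g" k] by (simp add: uminus_l1.rep_eq)

lemma coord_unit [simp]: "coord (unit_l1 n) k = (if k = n then 1 else 0)"
  by (simp add: unit_l1.rep_eq)

lemma l1_eqI: "(\<And>k. coord f k = coord g k) \<Longrightarrow> f = g"
  by (intro coord_inject[THEN iffD1] ext) simp

lemma abs_coord_le_norm: "\<bar>coord f k\<bar> \<le> norm f"
proof -
  have "(\<Sum>i\<in>{k}. \<bar>coord f i\<bar>) \<le> (\<Sum>i. \<bar>coord f i\<bar>)"
    by (rule sum_le_suminf[OF summable_coord]) auto
  then show ?thesis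
    unfolding norm_l1_def by simp
qed

lemma bounded_linear_coord: "bounded_linear (\<lambda>f. coord f k)"
  by (rule bounded_linear_intro[where K = 1]) (auto simp: abs_coord_le_norm)

lemma continuous_on_coord [continuous_intros]:
  "continuous_on S f \<Longrightarrow> continuous_on S (\<lambda>x. coord (f x) k)"
  by (rule bounded_linear.continuous_on[OF bounded_linear_coord])

text \<open>Over a coordinate where \<open>f\<close> vanishes the \<open>\<ell>\<^sup>1\<close> norm is additive. This is why a new branch,
  parallel to a fresh coordinate, lies exactly as far from the old tree as the tree metric says.\<close>
lemma norm_add_unit:
  assumes "coord f n = 0"
  shows "norm (f + t *\<^sub>R unit_l1 n) = norm f + \<bar>t\<bar>"
proof -
  have sg: "(\<lambda>k. if k = n then \<bar>t\<bar> else 0) sums \<bar>t\<bar>"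
    by (rule sums_single)
  have sf: "(\<lambda>k. \<bar>coord f k\<bar>) sums norm f"
    using summable_coord[of f] by (simp add: norm_l1_def summable_sums)
  have "(\<lambda>k. \<bar>coord f k\<bar> + (if k = n then \<bar>t\<bar> else 0)) sums (norm f + \<bar>t\<bar>)"
    by (rule sums_add[OF sf sg])
  moreover have "(\<lambda>k. \<bar>coord f k\<bar> + (if k = n then \<bar>t\<bar> else 0)) = (\<lambda>k. \<bar>coord (f + t *\<^sub>R unit_l1 n) k\<bar>)"
    using assms by auto
  ultimately show ?thesis
    unfolding norm_l1_def by (metis sums_unique)
qed

lemma norm_unit_l1 [simp]: "norm (unit_l1 n) = 1"
  using norm_add_unit[of 0 n 1] by simp

lift_definition truncate :: "nat \<Rightarrow> l1 \<Rightarrow> l1" is "\<lambda>k f i. if i < k then f i else 0"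
  by (rule summable_finite[of "{..<k}" for k]) auto

lemma coord_truncate [simp]: "coord (truncate k f) i = (if i < k then coord f i else 0)"
  by (simp add: truncate.rep_eq)

lemma truncate_0 [simp]: "truncate 0 f = 0"
  by (rule l1_eqI) simp

lemma truncate_Suc: "truncate (Suc k) f = truncate k f + coord f k *\<^sub>R unit_l1 k"
  by (rule l1_eqI) (auto simp: less_Suc_eq)

lemma norm_truncate_le: "norm (truncate k f) \<le> norm f"
  unfolding norm_l1_def by (intro suminf_le summable_coord) auto

lemma bounded_linear_truncate: "bounded_linear (truncate k)"
  by (rule bounded_linear_intro[where K = 1]) (auto intro: l1_eqI simp: norm_truncate_le)

definition tail_norm :: "nat \<Rightarrow> l1 \<Rightarrow> real" where
  "tail_norm k f = norm (f - truncate k f)"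

lemma tail_norm_nonneg [simp]: "0 \<le> tail_norm k f"
  by (simp add: tail_norm_def)

lemma continuous_on_tail_norm: "continuous_on S (tail_norm k)"
  unfolding tail_norm_def [abs_def]
  by (intro continuous_intros bounded_linear.continuous_on[OF bounded_linear_truncate])

lemma tail_norm_add_unit_le: "tail_norm k (f + t *\<^sub>R unit_l1 n) \<le> tail_norm k f + \<bar>t\<bar>"
proof -
  have tu: "truncate k (f + g) = truncate k f + truncate k g" for f g
    by (rule l1_eqI) simp
  have "norm (g - truncate k g) \<le> norm g" for g
    unfolding norm_l1_def by (intro suminf_le summable_coord) auto
  from this[of "t *\<^sub>R unit_l1 n"]
  have "norm (t *\<^sub>R unit_l1 n - truncate k (t *\<^sub>R unit_l1 n)) \<le> \<bar>t\<bar>"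
    by simp
  moreover have "f + t *\<^sub>R unit_l1 n - truncate k (f + t *\<^sub>R unit_l1 n)
      = (f - truncate k f) + (t *\<^sub>R unit_l1 n - truncate k (t *\<^sub>R unit_l1 n))"
    by (simp add: tu)
  ultimately show ?thesis
    unfolding tail_norm_def
    using norm_triangle_ineq[of "f - truncate k f" "t *\<^sub>R unit_l1 n - truncate k (t *\<^sub>R unit_l1 n)"]
    by (metis add_left_mono order_trans)
qed

lemma tail_norm_eq_0: "(\<And>i. k \<le> i \<Longrightarrow> coord f i = 0) \<Longrightarrow> tail_norm k f = 0"
  by (simp add: tail_norm_def) (rule l1_eqI, simp)

lemma tail_norm_tendsto_0: "(\<lambda>k. tail_norm k f) \<longlonglongrightarrow> 0"
proof -
  have "tail_norm k f = (\<Sum>i. \<bar>coord f (i + k)\<bar>)" for k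
  proof -
    have "tail_norm k f = (\<Sum>i. \<bar>coord (f - truncate k f) (i + k)\<bar>)
        + (\<Sum>i<k. \<bar>coord (f - truncate k f) i\<bar>)"
      unfolding tail_norm_def norm_l1_def by (rule suminf_split_initial_segment[OF summable_coord])
    then show ?thesis by simp
  qed
  then show ?thesis
    using suminf_exist_split2[OF summable_coord[of f]] by simp
qed

text \<open>Separability, by rational points of finite support, makes the Borel sets of products
  the product \<open>\<sigma>\<close>-algebras.\<close>
instance l1 :: second_countable_topology
proof
  define D :: "nat \<Rightarrow> l1 set" where
    "D = rec_nat {0} (\<lambda>k S. (\<lambda>(x, q). x + q *\<^sub>R unit_l1 k) ` (S \<times> \<rat>))"
  have D0: "D 0 = {0}" and DS: "D (Suc k) = (\<lambda>(x, q). x + q *\<^sub>R unit_l1 k) ` (D k \<times> \<rat>)" for k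
    by (simp_all add: D_def)
  have cD: "countable (D k)" for k
    by (induction k) (auto simp: D0 DS countable_rat)
  have approx: "\<exists>d\<in>D k. dist (truncate k f) d < e" if "0 < e" for f k e
    using that
  proof (induction k arbitrary: e)
    case 0
    then show ?case by (simp add: D0)
  next
    case (Suc k)
    obtain d where d: "d \<in> D k" "dist (truncate k f) d < e / 2"
      using Suc.IH[of "e / 2"] Suc.prems by auto
    obtain q where q: "q \<in> \<rat>" "coord f k < q" "q < coord f k + e / 2"
      using Rats_dense_in_real[of "coord f k" "coord f k + e / 2"] Suc.prems by auto
    have "truncate (Suc k) f - (d + q *\<^sub>R unit_l1 k)
        = (truncate k f - d) + (coord f k - q) *\<^sub>R unit_l1 k"
      by (simp add: truncate_Suc algebra_simps)
    then have "dist (truncate (Suc k) f) (d + q *\<^sub>R unit_l1 k)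
        \<le> dist (truncate k f) d + \<bar>coord f k - q\<bar>"
      using norm_triangle_ineq[of "truncate k f - d" "(coord f k - q) *\<^sub>R unit_l1 k"]
      unfolding dist_norm by (metis norm_scaleR norm_unit_l1 mult.right_neutral)
    also have "\<dots> < e"
      using d q by simp
    finally show ?case
      using d(1) q(1) unfolding DS
      by (intro bexI[of _ "d + q *\<^sub>R unit_l1 k"] image_eqI[of _ _ "(d, q)"]) auto
  qed
  define B where "B = (\<lambda>(d, q). ball d q) ` ((\<Union>k. D k) \<times> \<rat>)"
  have cB: "countable B"
    unfolding B_def using cD by (intro countable_image countable_SIGMA countable_UN countable_rat) auto
  have "topological_basis B"
  proof (rule topological_basisI)
    show "open b" if "b \<in> B" for b
      using that by (auto simp: B_def)
    fix S :: "l1 set" and f assume S: "open S" "f \<in> S"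
    then obtain e where e: "0 < e" "ball f e \<subseteq> S"
      by (auto simp: open_contains_ball)
    obtain q where q: "q \<in> \<rat>" "e / 4 < q" "q < e / 2"
      using Rats_dense_in_real[of "e / 4" "e / 2"] e by auto
    have "\<forall>\<^sub>F k in sequentially. tail_norm k f < e / 8"
      using order_tendstoD(2)[OF tail_norm_tendsto_0[of f], of "e / 8"] e(1) by simp
    then obtain k where k: "tail_norm k f < e / 8"
      by (auto simp: eventually_sequentially)
    obtain d where d: "d \<in> D k" "dist (truncate k f) d < e / 8"
      using approx[of "e / 8"] e(1) by auto
    have fd: "dist f d < e / 4"
      using k d(2) dist_triangle[of f d "truncate k f"] by (simp add: tail_norm_def dist_norm)
    have "f \<in> ball d q"
      using fd q by (simp add: dist_commute)
    moreover have "ball d q \<subseteq> S"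
    proof
      fix y assume "y \<in> ball d q"
      then have "dist f y < e"
        using fd q dist_triangle[of f y d] by simp
      then show "y \<in> S" using e(2) by auto
    qed
    moreover have "ball d q \<in> B"
      using d(1) q(1) by (auto simp: B_def)
    ultimately show "\<exists>B'\<in>B. f \<in> B' \<and> B' \<subseteq> S" by blast
  qed
  then show "\<exists>B::l1 set set. countable B \<and> open = generate_topology B"
    using cB topological_basis_imp_subbasis by blast
qed

text \<open>The points with coordinates in \<open>[0, a 1] \<times> [0, a 2] \<times> \<dots>\<close>, vanishing from
  the \<open>n\<close>-th coordinate on. They contain the tree with \<open>n\<close> branches wherever each branch is glued to the
  earlier ones, so they localize the random trees deterministically.\<close>
definition box_l1 :: "(nat \<Rightarrow> real) \<Rightarrow> nat \<Rightarrow> l1 set" where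
  "box_l1 a n = {x. (\<forall>i<n. 0 \<le> coord x i \<and> coord x i \<le> a (Suc i)) \<and> (\<forall>i\<ge>n. coord x i = 0)}"

lemma closed_box_l1: "closed (box_l1 a n)"
proof -
  have "box_l1 a n = (\<Inter>i\<in>{..<n}. {x. 0 \<le> coord x i} \<inter> {x. coord x i \<le> a (Suc i)})
      \<inter> (\<Inter>i\<in>{n..}. {x. coord x i = 0})"
    by (auto simp: box_l1_def)
  then show ?thesis
    by (simp only:) (intro closed_Int closed_INT ballI closed_Collect_le closed_Collect_eq
        continuous_on_coord continuous_on_id continuous_on_const)
qed

lemma compact_box_l1: "compact (box_l1 a n)"
proof (induction n)
  case 0
  have "box_l1 a 0 \<subseteq> {0}"
    by (auto simp: box_l1_def intro!: l1_eqI)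
  then have "finite (box_l1 a 0)"
    by (rule finite_subset) simp
  then show ?case
    by (rule finite_imp_compact)
next
  case (Suc n)
  have "compact ((\<lambda>(x, t). x + t *\<^sub>R unit_l1 n) ` (box_l1 a n \<times> {0..a (Suc n)}))"
    unfolding case_prod_unfold
    by (intro compact_continuous_image compact_Times Suc.IH continuous_intros) simp
  moreover have "box_l1 a (Suc n) \<subseteq> (\<lambda>(x, t). x + t *\<^sub>R unit_l1 n) ` (box_l1 a n \<times> {0..a (Suc n)})"
  proof
    fix x assume x: "x \<in> box_l1 a (Suc n)"
    have "x = truncate n x + coord x n *\<^sub>R unit_l1 n"
      using x by (intro l1_eqI) (auto simp: box_l1_def not_less)
    moreover have "truncate n x \<in> box_l1 a n"
      using x by (auto simp: box_l1_def)
    moreover have "coord x n \<in> {0..a (Suc n)}"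
      using x by (auto simp: box_l1_def)
    ultimately show "x \<in> (\<lambda>(x, t). x + t *\<^sub>R unit_l1 n) ` (box_l1 a n \<times> {0..a (Suc n)})"
      by (intro image_eqI[of _ _ "(truncate n x, coord x n)"]) auto
  qed
  ultimately show ?case
    using compact_Int_closed[OF _ closed_box_l1[of a "Suc n"]] by (metis inf_absorb2)
qed

definition tail_compact :: "(nat \<Rightarrow> real) \<Rightarrow> (nat \<Rightarrow> nat) \<Rightarrow> l1 set" where
  "tail_compact a k = {x. (\<forall>i. 0 \<le> coord x i \<and> coord x i \<le> a (Suc i)) \<and>
     (\<forall>j. tail_norm (k j) x \<le> (1 / 2) ^ j)}"

text \<open>Bounded coordinates together with uniformly small tails along one sequence of truncations
  give total boundedness, the truncations being confined to compact boxes.\<close>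
lemma compact_tail_compact: "compact (tail_compact a k)"
  unfolding compact_eq_totally_bounded
proof (intro conjI allI impI)
  have "tail_compact a k = (\<Inter>i. {x. 0 \<le> coord x i} \<inter> {x. coord x i \<le> a (Suc i)})
      \<inter> (\<Inter>j. {x. tail_norm (k j) x \<le> (1 / 2) ^ j})"
    by (auto simp: tail_compact_def)
  then have "closed (tail_compact a k)"
    by (simp only:) (intro closed_Int closed_INT ballI closed_Collect_le
        continuous_on_coord continuous_on_id continuous_on_const continuous_on_tail_norm)
  then show "Topological_Spaces.complete (tail_compact a k)"
    by (simp add: complete_eq_closed)
  fix e :: real assume e: "0 < e"
  obtain j where j: "(1 / 2) ^ j < e / 2"
    using real_arch_pow_inv[of "e / 2" "1 / 2"] e by auto
  obtain F where F: "finite F" "box_l1 a (k j) \<subseteq> (\<Union>x\<in>F. ball x (e / 2))"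
    using compact_box_l1[of a "k j", unfolded compact_eq_totally_bounded] half_gt_zero[OF e] by metis
  have "tail_compact a k \<subseteq> (\<Union>x\<in>F. ball x e)"
  proof
    fix x assume x: "x \<in> tail_compact a k"
    then have "truncate (k j) x \<in> box_l1 a (k j)"
      by (auto simp: box_l1_def tail_compact_def)
    then obtain y where y: "y \<in> F" "dist y (truncate (k j) x) < e / 2"
      using F(2) by auto
    have "tail_norm (k j) x \<le> (1 / 2) ^ j"
      using x by (simp add: tail_compact_def)
    then have "dist x (truncate (k j) x) < e / 2"
      using j by (simp add: tail_norm_def dist_norm)
    then have "dist y x < e"
      using y(2) dist_triangle[of y x "truncate (k j) x"] by (simp add: dist_commute)
    then show "x \<in> (\<Union>x\<in>F. ball x e)"
      using y(1) by auto
  qed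
  then show "\<exists>F. finite F \<and> tail_compact a k \<subseteq> (\<Union>x\<in>F. ball x e)"
    using F(1) by blast
qed

section \<open>The energy lower bound for Hausdorff measures\<close>

definition close_pairs :: "'a::metric_space measure \<Rightarrow> real \<Rightarrow> ennreal" where
  "close_pairs \<nu> r = (\<integral>\<^sup>+ x. \<integral>\<^sup>+ y. indicator {..r} (dist x y) \<partial>\<nu> \<partial>\<nu>)"

text \<open>The energy \<open>\<integral>\<integral> dist x y powr - s \<partial>\<nu> \<partial>\<nu>\<close> up to constants, cut off to the dyadic scales in \<open>J\<close>:
  the measures on finite trees are one-dimensional at small scales, where the full energy
  of order \<open>s \<ge> 1\<close> would be infinite.\<close>
definition dyadic_energy :: "real \<Rightarrow> nat set \<Rightarrow> 'a::metric_space measure \<Rightarrow> ennreal" where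
  "dyadic_energy s J \<nu> = (\<Sum>j\<in>J. ennreal (2 powr (s * real j)) * close_pairs \<nu> ((1 / 2) ^ j))"

text \<open>The squares \<open>D i \<times> D i\<close> are disjoint and consist of pairs that are close at the scale \<open>j i\<close>, so the weighted sum of
  their measures is part of the energy.\<close>
lemma sum_measure_le_dyadic_energy:
  fixes \<nu> :: "'a::{metric_space, second_countable_topology} measure" and m :: nat
  assumes "prob_space \<nu>" and sets_\<nu> [measurable_cong, simp]: "sets \<nu> = sets borel"
    and "finite J" and jJ: "\<And>i. i < m \<Longrightarrow> j i \<in> J"
    and D [measurable]: "\<And>i. D i \<in> sets borel" and disj: "disjoint_family D"
    and close: "\<And>i x y. x \<in> D i \<Longrightarrow> y \<in> D i \<Longrightarrow> dist x y \<le> (1 / 2) ^ j i"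
    and R: "dyadic_energy s J \<nu> \<le> ennreal R" "0 \<le> R"
  shows "(\<Sum>i<m. measure \<nu> (D i))\<^sup>2 \<le> R * (\<Sum>i<m. 2 powr (- s * real (j i)))"
proof -
  interpret prob_space \<nu> by fact
  define w where "w k = 2 powr (s * real k)" for k
  have w: "0 < w k" for k by (simp add: w_def)
  have pointwise: "(\<Sum>i<m. ennreal (w (j i)) * (indicator (D i) x * indicator (D i) y))
      \<le> (\<Sum>k\<in>J. ennreal (w k) * indicator {..(1 / 2) ^ k} (dist x y))" for x y
  proof (cases "\<exists>i<m. x \<in> D i \<and> y \<in> D i")
    case True
    then obtain i where i: "i < m" "x \<in> D i" "y \<in> D i" by auto
    have other: "l \<noteq> i \<Longrightarrow> x \<notin> D l" for l
      using disj i(2) by (auto simp: disjoint_family_on_def)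
    have "(\<Sum>l<m. ennreal (w (j l)) * (indicator (D l) x * indicator (D l) y))
        = (\<Sum>l\<in>{i}. ennreal (w (j l)) * (indicator (D l) x * indicator (D l) y))"
      using i(1) other by (intro sum.mono_neutral_right) auto
    also have "\<dots> = ennreal (w (j i)) * indicator {..(1 / 2) ^ j i} (dist x y)"
      using i close[OF i(2,3)] by simp
    also have "\<dots> \<le> (\<Sum>k\<in>J. ennreal (w k) * indicator {..(1 / 2) ^ k} (dist x y))"
      using jJ[OF i(1)] \<open>finite J\<close> by (intro member_le_sum) auto
    finally show ?thesis .
  next
    case False
    then have "(\<Sum>i<m. ennreal (w (j i)) * (indicator (D i) x * indicator (D i) y)) = 0"
      by (intro sum.neutral) (auto simp: indicator_def)
    then show ?thesis by (simp only: zero_le)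
  qed
  have "(\<Sum>i<m. ennreal (w (j i)) * (emeasure \<nu> (D i) * emeasure \<nu> (D i)))
      = (\<integral>\<^sup>+ x. \<integral>\<^sup>+ y. (\<Sum>i<m. ennreal (w (j i)) * (indicator (D i) x * indicator (D i) y)) \<partial>\<nu> \<partial>\<nu>)"
    by (simp add: nn_integral_sum nn_integral_cmult nn_integral_multc)
  also have "\<dots> \<le> (\<integral>\<^sup>+ x. \<integral>\<^sup>+ y. (\<Sum>k\<in>J. ennreal (w k) * indicator {..(1 / 2) ^ k} (dist x y)) \<partial>\<nu> \<partial>\<nu>)"
    by (intro nn_integral_mono pointwise)
  also have "\<dots> = dyadic_energy s J \<nu>"
    unfolding dyadic_energy_def close_pairs_def w_def
    by (simp add: nn_integral_sum nn_integral_cmult)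
  also have "\<dots> \<le> ennreal R" by fact
  finally have "(\<Sum>i<m. w (j i) * (measure \<nu> (D i))\<^sup>2) \<le> R"
    using w R(2) by (simp add: emeasure_eq_measure power2_eq_square sum_nonneg less_imp_le
        flip: ennreal_mult ennreal_mult')
  moreover have "(\<Sum>i<m. measure \<nu> (D i))\<^sup>2
      \<le> (\<Sum>i<m. w (j i) * (measure \<nu> (D i))\<^sup>2) * (\<Sum>i<m. 2 powr (- s * real (j i)))"
  proof -
    define v where "v k = 2 powr (s * real k / 2)" for k
    have v2: "(v k)\<^sup>2 = w k" for k
      by (simp add: v_def w_def power2_eq_square flip: powr_add)
    have "(1 / v k)\<^sup>2 = 2 powr (- s * real k)" for k
      by (simp add: power_divide v2 w_def powr_minus_divide)
    moreover have "v k \<noteq> 0" for k by (simp add: v_def)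
    ultimately show ?thesis
      using Cauchy_Schwarz_ineq_sum[of "\<lambda>i. v (j i) * measure \<nu> (D i)" "\<lambda>i. 1 / v (j i)" "{..<m}"]
      by (simp add: power_mult_distrib v2)
  qed
  ultimately show ?thesis
    by (meson mult_right_mono order_trans powr_ge_zero sum_nonneg)
qed

text \<open>A set of diameter \<open>d\<close> is covered by a ball of dyadic radius comparable to \<open>d\<close>; the summand \<open>e\<close>
  is the price for sets of diameter zero.\<close>
lemma dyadic_radius:
  fixes d e s :: real
  assumes "0 \<le> d" "d \<le> 1 / 4" "0 < e" "0 < s"
  shows "\<exists>j. d < (1 / 2) ^ Suc j \<and> 2 powr (- s * real j) \<le> 4 powr s * d powr s + e"
proof (cases "d = 0")
  case True
  have "2 powr (- s) < (1::real)"
    using assms by (simp add: powr_less_one)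
  then obtain j where "(2 powr (- s)) ^ j < e"
    using real_arch_pow_inv[of e "2 powr (- s)"] assms by auto
  then have "2 powr (- s * real j) < e"
    by (simp add: powr_powr flip: powr_realpow)
  then show ?thesis
    using True by (intro exI[of _ j]) simp
next
  case False
  define n where "n = (LEAST n. (1 / 2) ^ n \<le> d)"
  obtain n0 where "(1 / 2) ^ n0 < d"
    using real_arch_pow_inv[of d "1 / 2"] False assms by auto
  then have n: "(1 / 2) ^ n \<le> d"
    unfolding n_def by (intro LeastI[of "\<lambda>n. (1 / 2) ^ n \<le> d" n0]) simp
  have "n \<noteq> 0"
  proof
    assume "n = 0"
    with n assms show False by simp
  qed
  moreover have "n \<noteq> 1"
  proof
    assume "n = 1"
    with n assms show False by simp
  qed
  ultimately obtain j where j: "n = Suc (Suc j)"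
    by (metis One_nat_def not0_implies_Suc)
  have "\<not> (1 / 2) ^ Suc j \<le> d"
    using not_less_Least[of "Suc j" "\<lambda>n. (1 / 2) ^ n \<le> d"] j by (simp add: n_def)
  moreover have "2 powr (- s * real j) \<le> 4 powr s * d powr s"
  proof -
    have "2 powr (- s * real j) = ((1 / 2) ^ j) powr s"
      by (simp add: powr_powr powr_divide powr_minus_divide mult.commute flip: powr_realpow)
    also have "\<dots> \<le> (4 * d) powr s"
      using n j assms by (intro powr_mono2) auto
    also have "\<dots> = 4 powr s * d powr s"
      using assms by (simp add: powr_mult)
    finally show ?thesis .
  qed
  ultimately show ?thesis
    using assms by (intro exI[of _ j]) auto
qed

text \<open>The energy method, without a limit measure: a countable cover of \<open>T\<close> with small
  \<open>t\<close>-dimensional sum is thinned to finitely many balls covering the compact set \<open>T \<inter> K\<close>. These only involve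
  finitely many scales, so the truncated energy of some \<open>\<nu> n\<close> that charges \<open>K\<close> sees all of them, and the
  Cauchy-Schwarz inequality bounds the cover from below.\<close>
lemma hausdorff_measure_neq_0:
  fixes T K :: "'a::{metric_space, second_countable_topology} set" and \<nu> :: "nat \<Rightarrow> 'a measure"
  assumes T: "closed T" and K: "compact K"
    and prob: "\<And>n. prob_space (\<nu> n)" and sets_\<nu>: "\<And>n. sets (\<nu> n) = sets borel"
    and supp: "\<And>n. AE x in \<nu> n. x \<in> T"
    and J: "\<And>n. finite (J n)" "\<And>j. \<forall>\<^sub>F n in sequentially. j \<in> J n"
    and freq: "\<exists>\<^sub>F n in sequentially. 1 / 2 \<le> measure (\<nu> n) K \<and> dyadic_energy s (J n) (\<nu> n) \<le> ennreal R"
    and t: "0 < t" "t \<le> s" and R: "0 \<le> R"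
  shows "hausdorff_measure t T \<noteq> 0"
proof
  assume zero: "hausdorff_measure t T = 0"
  define \<eta> where "\<eta> = 1 / (8 * (4 powr s + 2) * (R + 1))"
  have c: "0 < 4 powr s + (2::real)" by (intro add_pos_pos) auto
  have \<eta>: "0 < \<eta>" using c R by (simp add: \<eta>_def)
  \<comment> \<open>Diameters up to \<open>1 / 4\<close> fit into dyadic balls of radius at most \<open>1 / 2\<close>; being below \<open>1\<close>, they also allow
    passing from the exponent \<open>t\<close> to the larger exponent \<open>s\<close>.\<close>
  have "hausdorff_premeasure t (1 / 4) T \<le> hausdorff_measure t T"
    unfolding hausdorff_measure_def by (rule SUP_upper) simp
  then have "hausdorff_premeasure t (1 / 4) T < ennreal \<eta>"
    using zero \<eta> by simp
  then obtain E where E: "T \<subseteq> (\<Union>i. E i)" "\<And>i. bounded (E i)" "\<And>i. diameter (E i) \<le> 1 / 4"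
    and E_sum: "(\<Sum>i. ennreal (diameter (E i) powr t)) < ennreal \<eta>"
    unfolding hausdorff_premeasure_def by (auto simp: INF_less_iff)
  define d where "d i = diameter (E i)" for i
  have d: "0 \<le> d i" "d i \<le> 1 / 4" for i
    using E(3) diameter_ge_0[OF E(2)] by (auto simp: d_def)
  have s: "0 < s" using t by simp
  have "\<exists>j. d i < (1 / 2) ^ Suc j \<and> 2 powr (- s * real j) \<le> 4 powr s * d i powr s + \<eta> * (1 / 2) ^ i" for i
    by (rule dyadic_radius) (use d \<eta> s in auto)
  then obtain j where j: "\<And>i. d i < (1 / 2) ^ Suc (j i)"
    "\<And>i. 2 powr (- s * real (j i)) \<le> 4 powr s * d i powr s + \<eta> * (1 / 2) ^ i"
    by metis
  define x where "x i = (SOME x. x \<in> E i)" for i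
  define B where "B i = ball (x i) ((1 / 2) ^ Suc (j i))" for i
  have EB: "E i \<subseteq> B i" for i
  proof
    fix y assume y: "y \<in> E i"
    then have "x i \<in> E i" unfolding x_def by (rule someI)
    then have "dist (x i) y \<le> d i"
      unfolding d_def using E(2) y by (intro diameter_bounded_bound) auto
    then show "y \<in> B i" using j(1)[of i] by (simp add: B_def)
  qed
  have "compact (T \<inter> K)"
    using K T by (simp add: compact_Int_closed Int_commute)
  moreover have "T \<inter> K \<subseteq> (\<Union>i\<in>UNIV. B i)"
    using E(1) EB by blast
  ultimately obtain I where I: "finite I" "T \<inter> K \<subseteq> (\<Union>i\<in>I. B i)"
    using compactE_image[of "T \<inter> K" UNIV B] by (auto simp: B_def)
  obtain m where m: "I \<subseteq> {..<m}"
    using I(1) finite_nat_iff_bounded by blast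
  have "\<forall>\<^sub>F n in sequentially. \<forall>i\<in>{..<m}. j i \<in> J n"
    by (intro eventually_ball_finite ballI J) simp
  with freq have "\<exists>\<^sub>F n in sequentially. (1 / 2 \<le> measure (\<nu> n) K \<and> dyadic_energy s (J n) (\<nu> n) \<le> ennreal R)
      \<and> (\<forall>i\<in>{..<m}. j i \<in> J n)"
    by (rule frequently_eventually_frequently)
  then obtain n where n: "1 / 2 \<le> measure (\<nu> n) K" "dyadic_energy s (J n) (\<nu> n) \<le> ennreal R"
    "\<And>i. i < m \<Longrightarrow> j i \<in> J n"
    by (auto dest!: frequently_ex)
  interpret \<nu>: prob_space "\<nu> n" by fact
  note [simp] = sets_\<nu>
  define D where "D = disjointed B"
  have "range B \<subseteq> sets borel"
    by (auto simp: B_def)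
  then have D_meas: "D i \<in> sets borel" for i
    unfolding D_def using sets.range_disjointed_sets[of B borel] by auto
  have disj: "disjoint_family D" unfolding D_def by (rule disjoint_family_disjointed)
  have DB: "D i \<subseteq> B i" for i unfolding D_def by (rule disjointed_subset)
  have dist_B: "dist y z \<le> (1 / 2) ^ j i" if "y \<in> B i" "z \<in> B i" for i y z
    using that dist_triangle_half_r[of "x i" y "(1 / 2) ^ j i" z] by (simp add: B_def)
  have close: "dist y z \<le> (1 / 2) ^ j i" if "y \<in> D i" "z \<in> D i" for i y z
    by (rule dist_B) (use that DB in auto)
  have D_Un: "(\<Union>i<m. D i) = (\<Union>i<m. B i)"
    using finite_UN_disjointed_eq[of B m] by (simp add: D_def atLeast0LessThan)
  have "1 / 2 \<le> measure (\<nu> n) K" by fact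
  also have "\<dots> = measure (\<nu> n) (T \<inter> K)"
    using supp[of n] T K by (intro \<nu>.finite_measure_eq_AE) (auto intro: borel_closed compact_imp_closed)
  also have "\<dots> \<le> measure (\<nu> n) (\<Union>i<m. D i)"
  proof (intro \<nu>.finite_measure_mono)
    show "T \<inter> K \<subseteq> (\<Union>i<m. D i)" unfolding D_Un using I m by blast
    show "(\<Union>i<m. D i) \<in> sets (\<nu> n)" using D_meas by (auto intro: sets.finite_UN)
  qed
  also have "\<dots> = (\<Sum>i<m. measure (\<nu> n) (D i))"
    using D_meas disj by (intro \<nu>.finite_measure_finite_Union)
      (auto simp: disjoint_family_on_def)
  finally have "(1 / 2)\<^sup>2 \<le> (\<Sum>i<m. measure (\<nu> n) (D i))\<^sup>2"
    by (intro power_mono) auto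
  also have "\<dots> \<le> R * (\<Sum>i<m. 2 powr (- s * real (j i)))"
    using prob sets_\<nu> J(1) n(3) D_meas disj close n(2) R
    by (rule sum_measure_le_dyadic_energy)
  also have "\<dots> \<le> R * ((4 powr s + 2) * \<eta>)"
  proof (rule mult_left_mono[OF _ R])
    have "ennreal (\<Sum>i<m. d i powr t) = (\<Sum>i<m. ennreal (d i powr t))"
      by simp
    also have "\<dots> \<le> (\<Sum>i. ennreal (d i powr t))"
      by (intro sum_le_suminf) auto
    also have "\<dots> < ennreal \<eta>"
      using E_sum by (simp add: d_def)
    finally have "(\<Sum>i<m. d i powr t) < \<eta>"
      by (subst (asm) ennreal_less_iff) (auto intro: sum_nonneg)
    then have "(\<Sum>i<m. d i powr t) \<le> \<eta>" by simp
    moreover have "d i powr s \<le> d i powr t" for i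
      using d[of i] t by (intro powr_mono') auto
    ultimately have dt: "(\<Sum>i<m. d i powr s) \<le> \<eta>"
      by (meson order_trans sum_mono)
    have geo: "(\<Sum>i<m. (1 / 2) ^ i) \<le> (2::real)"
      using sum_gp_strict[of "1 / 2 :: real" m] by simp
    have "(\<Sum>i<m. 2 powr (- s * real (j i))) \<le> (\<Sum>i<m. 4 powr s * d i powr s + \<eta> * (1 / 2) ^ i)"
      by (intro sum_mono j)
    also have "\<dots> = 4 powr s * (\<Sum>i<m. d i powr s) + \<eta> * (\<Sum>i<m. (1 / 2) ^ i)"
      by (simp add: sum.distrib sum_distrib_left)
    also have "\<dots> \<le> 4 powr s * \<eta> + \<eta> * 2"
      using dt geo \<eta> by (intro add_mono mult_left_mono) auto
    finally show "(\<Sum>i<m. 2 powr (- s * real (j i))) \<le> (4 powr s + 2) * \<eta>"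
      by (simp add: algebra_simps)
  qed
  also have "\<dots> = R / (R + 1) * (1 / 8)"
  proof -
    have "R * (c * (1 / (8 * c * (R + 1)))) = R / (R + 1) * (1 / 8)" if "0 < c" for c
      using that by simp
    then show ?thesis using c unfolding \<eta>_def by blast
  qed
  also have "\<dots> \<le> 1 / 8"
    using R by (simp add: divide_simps)
  finally show False by (simp add: power2_eq_square)
qed

section \<open>The length measure of a finite tree\<close>

text \<open>The domain of the parametrization of the tree by its branches. Unlike the tree it is not random, so
  Fubini's theorem applies to integrals over a random history and a point of the tree.\<close>
definition segments :: "(nat \<Rightarrow> real) \<Rightarrow> nat \<Rightarrow> (nat \<times> real) measure" where
  "segments a n = restrict_space (count_space UNIV \<Otimes>\<^sub>M lborel) (SIGMA i:{..<n}. {0..a (Suc i)})"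

lemma SIGMA_segments_sets:
  "(SIGMA i:{..<n}. {0..a (Suc i)}) \<in> sets (count_space (UNIV :: nat set) \<Otimes>\<^sub>M (lborel :: real measure))"
proof -
  have "(SIGMA i:{..<n}. {0..a (Suc i)}) = (\<Union>i<n. {i} \<times> {0..a (Suc i)})"
    by auto
  then show ?thesis by simp
qed

lemma nn_integral_segments:
  assumes g: "g \<in> borel_measurable (segments a n)"
  shows "(\<integral>\<^sup>+ p. g p \<partial>segments a n) = (\<Sum>i<n. \<integral>\<^sup>+ x. g (i, x) * indicator {0..a (Suc i)} x \<partial>lborel)"
proof -
  let ?\<Omega> = "SIGMA i:{..<n}. {0..a (Suc i)}"
  have "(\<integral>\<^sup>+ p. g p \<partial>segments a n) = (\<integral>\<^sup>+ p. g p * indicator ?\<Omega> p \<partial>(count_space UNIV \<Otimes>\<^sub>M lborel))"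
    unfolding segments_def by (rule nn_integral_restrict_space) (simp add: SIGMA_segments_sets)
  also have "\<dots> = (\<integral>\<^sup>+ i. \<integral>\<^sup>+ x. g (i, x) * indicator ?\<Omega> (i, x) \<partial>lborel \<partial>count_space UNIV)"
  proof (rule lborel.nn_integral_fst[symmetric])
    show "(\<lambda>p. g p * indicator ?\<Omega> p) \<in> borel_measurable (count_space UNIV \<Otimes>\<^sub>M lborel)"
      using g SIGMA_segments_sets[of n a] unfolding segments_def
      by (subst (asm) borel_measurable_restrict_space_iff_ennreal) auto
  qed
  also have "\<dots> = (\<Sum>i<n. \<integral>\<^sup>+ x. g (i, x) * indicator ?\<Omega> (i, x) \<partial>lborel)"
    by (rule nn_integral_count_space') auto
  also have "\<dots> = (\<Sum>i<n. \<integral>\<^sup>+ x. g (i, x) * indicator {0..a (Suc i)} x \<partial>lborel)"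
    by (intro sum.cong nn_integral_cong) (auto simp: indicator_def)
  finally show ?thesis .
qed

lemma finite_measure_segments: "finite_measure (segments a n)"
proof (rule finite_measureI)
  have "emeasure (segments a n) (space (segments a n)) = (\<integral>\<^sup>+ p. 1 \<partial>segments a n)"
    by simp
  also have "\<dots> = (\<Sum>i<n. emeasure lborel {0..a (Suc i)})"
    by (subst nn_integral_segments) auto
  also have "\<dots> = (\<Sum>i<n. ennreal (max 0 (a (Suc i))))"
    by (intro sum.cong) (auto simp: emeasure_lborel_Icc_eq max_def ennreal_neg)
  also have "\<dots> = ennreal (\<Sum>i<n. max 0 (a (Suc i)))"
    by (rule sum_ennreal) simp
  also have "\<dots> < \<infinity>"
    by simp
  finally show "emeasure (segments a n) (space (segments a n)) \<noteq> \<infinity>"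
    by simp
qed

lemma measurable_branch:
  assumes U: "\<And>i. 1 \<le> i \<Longrightarrow> i < n \<Longrightarrow> U i \<in> borel_measurable N"
  shows "(\<lambda>(\<omega>, i, x). branch (\<lambda>k. U k \<omega>) i x) \<in> borel_measurable (N \<Otimes>\<^sub>M segments a n)"
proof -
  have "fst \<in> segments a n \<rightarrow>\<^sub>M restrict_space (count_space UNIV) {..<n}"
    unfolding segments_def
    by (rule measurable_restrict_space2) (auto intro: measurable_restrict_space1 simp: space_restrict_space)
  then have [measurable]: "fst \<in> segments a n \<rightarrow>\<^sub>M count_space {..<n}"
    by (simp add: restrict_count_space)
  have [measurable]: "snd \<in> segments a n \<rightarrow>\<^sub>M borel"
    unfolding segments_def
    by (rule measurable_restrict_space1) (use measurable_snd[of "count_space UNIV" lborel] in simp)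
  have "(\<lambda>p. (\<lambda>i p. branch (\<lambda>k. U k (fst p)) i (snd (snd p))) (fst (snd p)) p)
      \<in> borel_measurable (N \<Otimes>\<^sub>M segments a n)"
  proof (rule measurable_compose_countable'[where I = "{..<n}"])
    show "(\<lambda>p. fst (snd p)) \<in> N \<Otimes>\<^sub>M segments a n \<rightarrow>\<^sub>M count_space {..<n}"
      by measurable
    fix i assume i: "i \<in> {..<n}"
    show "(\<lambda>p. branch (\<lambda>k. U k (fst p)) i (snd (snd p))) \<in> borel_measurable (N \<Otimes>\<^sub>M segments a n)"
    proof (cases "i = 0")
      case False
      then have [measurable]: "U i \<in> borel_measurable N" using U i by auto
      show ?thesis using False unfolding branch_def by simp
    qed (simp add: branch_def)
  qed simp
  then show ?thesis by (simp add: case_prod_unfold)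
qed

lemma measurable_branch_segments: "(\<lambda>(i, x). branch u i x) \<in> borel_measurable (segments a n)"
  using measurable_compose[OF measurable_Pair1'[of "()" "count_space UNIV"]
      measurable_branch[of n "\<lambda>k _. u k" "count_space UNIV"]]
  by simp

lemma length_measure_distr: "length_measure a u n = distr (segments a n) borel (\<lambda>(i, x). branch u i x)"
  by (simp add: length_measure_def segments_def)

lemma sets_length_measure [measurable_cong, simp]: "sets (length_measure a u n) = sets borel"
  by (simp add: length_measure_distr)

lemma space_length_measure [simp]: "space (length_measure a u n) = UNIV"
  by (simp add: length_measure_distr)

lemma finite_measure_length_measure: "finite_measure (length_measure a u n)"
  unfolding length_measure_distr
  by (intro finite_measure.finite_measure_distr finite_measure_segments measurable_branch_segments)

lemma nn_integral_length_measure_segments: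
  assumes "f \<in> borel_measurable borel"
  shows "(\<integral>\<^sup>+ x. f x \<partial>length_measure a u n) = (\<integral>\<^sup>+ (i, x). f (branch u i x) \<partial>segments a n)"
  unfolding length_measure_distr
  by (subst nn_integral_distr) (use assms measurable_branch_segments in \<open>auto simp: case_prod_unfold\<close>)

lemma nn_integral_length_measure:
  assumes f: "f \<in> borel_measurable borel"
  shows "(\<integral>\<^sup>+ x. f x \<partial>length_measure a u n)
    = (\<Sum>i<n. \<integral>\<^sup>+ x. f (branch u i x) * indicator {0..a (Suc i)} x \<partial>lborel)"
proof -
  have "(\<lambda>p. f (case p of (i, x) \<Rightarrow> branch u i x)) \<in> borel_measurable (segments a n)"
    by (rule measurable_compose[OF measurable_branch_segments f])
  then show ?thesis
    using nn_integral_segments[of "\<lambda>p. f (case p of (i, x) \<Rightarrow> branch u i x)" a n]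
    by (simp add: nn_integral_length_measure_segments f case_prod_unfold)
qed

lemma nn_integral_length_measure_Suc:
  assumes "f \<in> borel_measurable borel"
  shows "(\<integral>\<^sup>+ x. f x \<partial>length_measure a u (Suc n)) = (\<integral>\<^sup>+ x. f x \<partial>length_measure a u n)
    + (\<integral>\<^sup>+ x. f (branch u n x) * indicator {0..a (Suc n)} x \<partial>lborel)"
  by (simp add: nn_integral_length_measure assms)

lemma measurable_nn_integral_length_measure:
  assumes g: "g \<in> borel_measurable (N \<Otimes>\<^sub>M borel)"
    and U: "\<And>i. 1 \<le> i \<Longrightarrow> i < n \<Longrightarrow> U i \<in> borel_measurable N"
  shows "(\<lambda>\<omega>. \<integral>\<^sup>+ x. g (\<omega>, x) \<partial>length_measure a (\<lambda>k. U k \<omega>) n) \<in> borel_measurable N"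
proof -
  interpret finite_measure "segments a n" by (rule finite_measure_segments)
  have "(\<lambda>p. g (fst p, (\<lambda>(\<omega>, i, x). branch (\<lambda>k. U k \<omega>) i x) p)) \<in> borel_measurable (N \<Otimes>\<^sub>M segments a n)"
    by (intro measurable_compose[OF measurable_Pair g] measurable_fst measurable_branch U)
  then have "(\<lambda>\<omega>. \<integral>\<^sup>+ p. g (fst (\<omega>, p), (\<lambda>(\<omega>, i, x). branch (\<lambda>k. U k \<omega>) i x) (\<omega>, p)) \<partial>segments a n)
      \<in> borel_measurable N"
    by (rule borel_measurable_nn_integral_fst)
  then show ?thesis
  proof (rule measurable_cong[THEN iffD1, rotated])
    fix \<omega> assume \<omega>: "\<omega> \<in> space N"
    have "(\<lambda>x. g (\<omega>, x)) \<in> borel_measurable borel"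
      using \<omega> by (intro measurable_compose[OF _ g] measurable_Pair1')
    then show "(\<integral>\<^sup>+ p. g (fst (\<omega>, p), (\<lambda>(\<omega>, i, x). branch (\<lambda>k. U k \<omega>) i x) (\<omega>, p)) \<partial>segments a n)
      = (\<integral>\<^sup>+ x. g (\<omega>, x) \<partial>length_measure a (\<lambda>k. U k \<omega>) n)"
      by (subst nn_integral_length_measure_segments) (auto simp: case_prod_unfold)
  qed
qed

lemma finite_tree_eq: "finite_tree a u n = (\<Union>i<n. branch u i ` {0..a (Suc i)})"
  by (induction n) (auto simp: lessThan_Suc)

lemma closed_finite_tree: "closed (finite_tree a u n)"
proof -
  have "continuous_on S (branch u i)" for i S
    unfolding branch_def [abs_def] by (intro continuous_intros)
  then have "closed (branch u i ` {0..a (Suc i)})" for i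
    by (intro compact_imp_closed compact_continuous_image) auto
  then show ?thesis
    unfolding finite_tree_eq by (intro closed_UN) auto
qed

lemma AE_length_measure_finite_tree: "AE x in length_measure a u n. x \<in> finite_tree a u n"
proof -
  have [measurable]: "finite_tree a u n \<in> sets borel"
    by (intro borel_closed closed_finite_tree)
  have "emeasure (length_measure a u n) (- finite_tree a u n)
      = (\<integral>\<^sup>+ x. indicator (- finite_tree a u n) x \<partial>length_measure a u n)"
    by (subst nn_integral_indicator) auto
  also have "\<dots> = (\<Sum>i<n. \<integral>\<^sup>+ x. indicator (- finite_tree a u n) (branch u i x) * indicator {0..a (Suc i)} x \<partial>lborel)"
    by (rule nn_integral_length_measure) auto
  also have "\<dots> = (\<Sum>i<n. \<integral>\<^sup>+ x. 0 \<partial>(lborel :: real measure))"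
  proof (intro sum.cong nn_integral_cong refl)
    fix i t assume "i \<in> {..<n}"
    then have "branch u i t \<in> finite_tree a u n" if "t \<in> {0..a (Suc i)}"
      unfolding finite_tree_eq using that by blast
    then show "indicator (- finite_tree a u n) (branch u i t) * indicator {0..a (Suc i)} t = (0 :: ennreal)"
      by (auto simp: indicator_def)
  qed
  finally show ?thesis
    by (intro AE_I[where N = "- finite_tree a u n"]) auto
qed

lemma emeasure_length_measure:
  assumes "\<And>i. 1 \<le> i \<Longrightarrow> 0 \<le> a i"
  shows "emeasure (length_measure a u n) (finite_tree a u n) = ennreal (partial_sum a n)"
proof -
  have "emeasure (length_measure a u n) (finite_tree a u n) = emeasure (length_measure a u n) UNIV"
    using AE_length_measure_finite_tree[of a u n] closed_finite_tree
    by (intro emeasure_eq_AE) (auto intro: borel_closed)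
  also have "\<dots> = (\<integral>\<^sup>+ x. 1 \<partial>length_measure a u n)"
    by simp
  also have "\<dots> = (\<Sum>i<n. emeasure lborel {0..a (Suc i)})"
    by (subst nn_integral_length_measure) auto
  also have "\<dots> = (\<Sum>i<n. ennreal (a (Suc i)))"
    using assms by (intro sum.cong) auto
  also have "\<dots> = ennreal (partial_sum a n)"
    using assms by (simp add: partial_sum_def sum_ennreal sum.atLeast1_atMost_eq)
  finally show ?thesis .
qed

lemma sets_uniform_on_tree [measurable_cong, simp]: "sets (uniform_on_tree a u n) = sets borel"
  by (simp add: uniform_on_tree_def)

lemma nn_integral_uniform_on_tree:
  assumes "\<And>i. 1 \<le> i \<Longrightarrow> 0 \<le> a i" and [measurable]: "f \<in> borel_measurable borel"
  shows "(\<integral>\<^sup>+ x. f x \<partial>uniform_on_tree a u n) = (\<integral>\<^sup>+ x. f x \<partial>length_measure a u n) / ennreal (partial_sum a n)"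
proof -
  have "finite_tree a u n \<in> sets (length_measure a u n)"
    by (simp add: borel_closed closed_finite_tree)
  then have "(\<integral>\<^sup>+ x. f x \<partial>uniform_on_tree a u n)
      = (\<integral>\<^sup>+ x. f x * indicator (finite_tree a u n) x \<partial>length_measure a u n) / ennreal (partial_sum a n)"
    unfolding uniform_on_tree_def
    by (subst nn_integral_uniform_measure) (auto simp: emeasure_length_measure assms(1))
  also have "(\<integral>\<^sup>+ x. f x * indicator (finite_tree a u n) x \<partial>length_measure a u n)
      = (\<integral>\<^sup>+ x. f x \<partial>length_measure a u n)"
  proof (rule nn_integral_cong_AE)
    show "AE x in length_measure a u n. f x * indicator (finite_tree a u n) x = f x"
      using AE_length_measure_finite_tree by eventually_elim simp
  qed
  finally show ?thesis .
qed

lemma prob_space_uniform_on_tree: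
  assumes "\<And>i. 1 \<le> i \<Longrightarrow> 0 \<le> a i" "0 < partial_sum a n"
  shows "prob_space (uniform_on_tree a u n)"
  unfolding uniform_on_tree_def
  using assms by (intro prob_space_uniform_measure) (auto simp: emeasure_length_measure)

section \<open>The law of the gluing points\<close>

lemma partial_sum_0 [simp]: "partial_sum a 0 = 0"
  by (simp add: partial_sum_def)

lemma partial_sum_Suc [simp]: "partial_sum a (Suc n) = partial_sum a n + a (Suc n)"
  by (simp add: partial_sum_def)

locale aggregation = prob_space M for M :: "'w measure" +
  fixes a :: "nat \<Rightarrow> real" and U :: "nat \<Rightarrow> 'w \<Rightarrow> l1"
  assumes a_pos: "1 \<le> i \<Longrightarrow> 0 < a i"
    and gluing: "uniform_gluing M a U"
begin

abbreviation "A \<equiv> partial_sum a"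

abbreviation "tree_length n \<omega> \<equiv> length_measure a (\<lambda>i. U i \<omega>) n"

lemma a_nonneg: "1 \<le> i \<Longrightarrow> 0 \<le> a i"
  using a_pos[of i] by simp

lemma A_pos: "1 \<le> n \<Longrightarrow> 0 < A n"
  unfolding partial_sum_def by (intro sum_pos) (auto intro: a_pos)

lemma A_nonneg: "0 \<le> A n"
  by (cases n) (auto intro: less_imp_le[OF A_pos] simp del: partial_sum_Suc)

lemma measurable_U [measurable]: "1 \<le> n \<Longrightarrow> U n \<in> borel_measurable M"
  using gluing by (simp add: uniform_gluing_def)

abbreviation "history n \<equiv> tree_history M U n"

lemma space_history [simp]: "space (history n) = space M"
  by (simp add: tree_history_def)

lemma measurable_into_history:
  "f \<in> N \<rightarrow>\<^sub>M M \<Longrightarrow> f \<in> N \<rightarrow>\<^sub>M history n"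
  unfolding tree_history_def
proof (rule measurable_vimage_algebra2)
  assume f [measurable]: "f \<in> N \<rightarrow>\<^sub>M M"
  show "f \<in> space N \<rightarrow> space M" using f by (rule measurable_space[THEN funcsetI])
  show "(\<lambda>x. \<lambda>i\<in>{1..<n}. U i (f x)) \<in> N \<rightarrow>\<^sub>M Pi\<^sub>M {1..<n} (\<lambda>_. borel)"
    by (rule measurable_restrict) simp
qed

lemma subalgebra_history: "subalgebra M (history n)"
  unfolding subalgebra_def
proof
  show "sets (history n) \<subseteq> sets M"
  proof
    fix C assume C: "C \<in> sets (history n)"
    have "(\<lambda>x. x) \<in> M \<rightarrow>\<^sub>M history n"
      by (rule measurable_into_history) simp
    from measurable_sets[OF this C] show "C \<in> sets M"
      using sets.sets_into_space[OF C] by (simp add: Int_absorb2)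
  qed
qed simp

lemma measurable_U_history: "1 \<le> i \<Longrightarrow> i < n \<Longrightarrow> U i \<in> borel_measurable (history n)"
proof -
  assume i: "1 \<le> i" "i < n"
  have "(\<lambda>\<omega>. \<lambda>i\<in>{1..<n}. U i \<omega>) \<in> history n \<rightarrow>\<^sub>M Pi\<^sub>M {1..<n} (\<lambda>_. borel)"
    unfolding tree_history_def
    by (rule measurable_vimage_algebra1) (auto simp: space_PiM)
  from measurable_compose[OF this measurable_component_singleton[of i "{1..<n}" "\<lambda>_. borel"]]
  show ?thesis using i by simp
qed

lemma emeasure_gluing_rectangle:
  assumes n: "1 \<le> n" and C: "C \<in> sets (history n)" and B [measurable]: "B \<in> sets borel"
  shows "ennreal (A n) * emeasure M (C \<inter> (U n -` B \<inter> space M))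
    = (\<integral>\<^sup>+ \<omega>. emeasure (tree_length n \<omega>) B * indicator C \<omega> \<partial>M)"
proof -
  interpret finite_measure_subalgebra M "history n"
    by unfold_locales (rule subalgebra_history)
  let ?\<mu> = "\<lambda>\<omega>. measure (uniform_on_tree a (\<lambda>i. U i \<omega>) n) B"
  note [measurable] = measurable_U[OF n]
  have C_M [measurable]: "C \<in> sets M"
    using C subalgebra_history[of n] by (auto simp: subalgebra_def)
  have An: "0 < A n" using n by (rule A_pos)
  have \<mu>: "emeasure (tree_length n \<omega>) B = ennreal (A n) * ennreal (?\<mu> \<omega>)" for \<omega>
  proof -
    interpret \<mu>: prob_space "uniform_on_tree a (\<lambda>i. U i \<omega>) n"
      by (rule prob_space_uniform_on_tree) (use a_nonneg An in auto)
    have "ennreal (?\<mu> \<omega>) = emeasure (tree_length n \<omega>) B / ennreal (A n)"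
      using nn_integral_uniform_on_tree[of a "indicator B" "\<lambda>i. U i \<omega>" n] a_nonneg
      by (simp add: \<mu>.emeasure_eq_measure)
    then have "ennreal (A n) * ennreal (?\<mu> \<omega>) = emeasure (tree_length n \<omega>) B * ennreal (A n) / ennreal (A n)"
      by (simp add: ennreal_times_divide mult.commute)
    then show ?thesis
      using An by (simp add: ennreal_mult_divide_eq)
  qed
  have meas: "(\<lambda>\<omega>. emeasure (tree_length n \<omega>) B) \<in> borel_measurable M"
    using measurable_nn_integral_length_measure[of "\<lambda>p. indicator B (snd p)" M n U a] measurable_U
    by simp
  have "?\<mu> = (\<lambda>\<omega>. enn2real (emeasure (tree_length n \<omega>) B / ennreal (A n)))"
    using An by (simp add: \<mu> ennreal_mult_divide_eq mult.commute[of "ennreal (A n)"])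
  then have \<mu>_meas [measurable]: "?\<mu> \<in> borel_measurable M"
    using meas by simp
  have \<mu>_le: "?\<mu> \<omega> \<le> 1" for \<omega>
    by (rule prob_space.prob_le_1[OF prob_space_uniform_on_tree]) (use a_nonneg An in auto)
  let ?V = "U n -` B \<inter> space M"
  have V [measurable]: "?V \<in> sets M" by measurable
  have "measure M (C \<inter> ?V) = (\<integral>\<omega>\<in>C. indicator ?V \<omega> \<partial>M)"
  proof -
    have "(\<lambda>\<omega>. indicator C \<omega> *\<^sub>R indicator ?V \<omega>) = (indicator (C \<inter> ?V) :: _ \<Rightarrow> real)"
      by (auto simp: indicator_def)
    then show ?thesis
      unfolding set_lebesgue_integral_def by simp
  qed
  also have "\<dots> = (\<integral>\<omega>\<in>C. real_cond_exp M (history n) (indicator ?V) \<omega> \<partial>M)"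
    by (rule real_cond_exp_intA[OF _ C]) (simp add: integrable_real_indicator emeasure_eq_measure)
  also have "\<dots> = (\<integral>\<omega>\<in>C. ?\<mu> \<omega> \<partial>M)"
  proof -
    have "AE \<omega> in M. real_cond_exp M (history n) (indicator ?V) \<omega> = ?\<mu> \<omega>"
      using gluing n B unfolding uniform_gluing_def by blast
    then show ?thesis
      unfolding set_lebesgue_integral_def
      by (intro integral_cong_AE) (auto elim: eventually_mono)
  qed
  finally have eq: "measure M (C \<inter> ?V) = (\<integral>\<omega>. indicator C \<omega> * ?\<mu> \<omega> \<partial>M)"
    by (simp add: set_lebesgue_integral_def)
  have "integrable M (\<lambda>\<omega>. indicator C \<omega> * ?\<mu> \<omega>)"
    using \<mu>_le by (intro integrable_const_bound[where B = 1]) (auto simp: indicator_def)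
  then have "ennreal (measure M (C \<inter> ?V)) = (\<integral>\<^sup>+ \<omega>. ennreal (indicator C \<omega> * ?\<mu> \<omega>) \<partial>M)"
    unfolding eq by (subst nn_integral_eq_integral) auto
  then have "emeasure M (C \<inter> ?V) = (\<integral>\<^sup>+ \<omega>. ennreal (?\<mu> \<omega>) * indicator C \<omega> \<partial>M)"
    by (simp add: emeasure_eq_measure ennreal_mult' ennreal_indicator mult.commute)
  then show ?thesis
    unfolding \<mu> by (subst mult.assoc) (simp add: nn_integral_cmult)
qed

text \<open>Up to the factor \<open>A n\<close>, the law of a history together with the next gluing point is the law of the history
  integrated against the length measure. Conditional uniformity gives this on rectangles, hence
  everywhere; every estimate on the random trees rests on this formula.\<close>
lemma nn_integral_gluing:
  assumes n: "1 \<le> n" and g: "g \<in> borel_measurable (history n \<Otimes>\<^sub>M borel)"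
  shows "ennreal (A n) * (\<integral>\<^sup>+ \<omega>. g (\<omega>, U n \<omega>) \<partial>M) = (\<integral>\<^sup>+ \<omega>. \<integral>\<^sup>+ x. g (\<omega>, x) \<partial>tree_length n \<omega> \<partial>M)"
proof -
  let ?N = "history n \<Otimes>\<^sub>M borel"
  let ?b = "\<lambda>(\<omega>, i, x). branch (\<lambda>k. U k \<omega>) i x"
  interpret S: finite_measure "segments a n" by (rule finite_measure_segments)
  have m1: "(\<lambda>\<omega>. (\<omega>, U n \<omega>)) \<in> M \<rightarrow>\<^sub>M ?N"
    using n by (intro measurable_Pair measurable_into_history) auto
  have m2: "(\<lambda>p. (fst p, ?b p)) \<in> M \<Otimes>\<^sub>M segments a n \<rightarrow>\<^sub>M ?N"
    by (intro measurable_Pair measurable_into_history measurable_fst measurable_branch measurable_U)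
  let ?P1 = "scale_measure (ennreal (A n)) (distr M ?N (\<lambda>\<omega>. (\<omega>, U n \<omega>)))"
  let ?P2 = "distr (M \<Otimes>\<^sub>M segments a n) ?N (\<lambda>p. (fst p, ?b p))"
  have P2: "(\<integral>\<^sup>+ p. h p \<partial>?P2) = (\<integral>\<^sup>+ \<omega>. \<integral>\<^sup>+ x. h (\<omega>, x) \<partial>tree_length n \<omega> \<partial>M)"
    if h: "h \<in> borel_measurable ?N" for h :: "'w \<times> l1 \<Rightarrow> ennreal"
  proof -
    have "(\<integral>\<^sup>+ p. h p \<partial>?P2) = (\<integral>\<^sup>+ p. h (fst p, ?b p) \<partial>(M \<Otimes>\<^sub>M segments a n))"
      by (subst nn_integral_distr[OF m2]) (use h in \<open>simp_all add: measurable_distr_eq1\<close>)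
    also have "\<dots> = (\<integral>\<^sup>+ \<omega>. \<integral>\<^sup>+ p. h (fst (\<omega>, p), ?b (\<omega>, p)) \<partial>segments a n \<partial>M)"
      by (rule S.nn_integral_fst[symmetric]) (rule measurable_compose[OF m2 h])
    also have "\<dots> = (\<integral>\<^sup>+ \<omega>. \<integral>\<^sup>+ x. h (\<omega>, x) \<partial>tree_length n \<omega> \<partial>M)"
    proof (rule nn_integral_cong)
      fix \<omega> assume \<omega>: "\<omega> \<in> space M"
      have "(\<lambda>x. h (\<omega>, x)) \<in> borel_measurable borel"
        using \<omega> by (intro measurable_compose[OF _ h] measurable_Pair1') simp
      then show "(\<integral>\<^sup>+ p. h (fst (\<omega>, p), ?b (\<omega>, p)) \<partial>segments a n) = (\<integral>\<^sup>+ x. h (\<omega>, x) \<partial>tree_length n \<omega>)"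
        by (subst nn_integral_length_measure_segments) (auto simp: case_prod_unfold)
    qed
    finally show ?thesis .
  qed
  have "?P1 = ?P2"
  proof (rule measure_eqI_generator_eq[where \<Omega> = "space M \<times> UNIV" and A = "\<lambda>_. space M \<times> UNIV"
        and E = "{C \<times> B | C B. C \<in> sets (history n) \<and> B \<in> sets (borel :: l1 measure)}"])
    show "Int_stable {C \<times> B | C B. C \<in> sets (history n) \<and> B \<in> sets (borel :: l1 measure)}"
      by (rule Int_stable_pair_measure_generator)
    show "{C \<times> B | C B. C \<in> sets (history n) \<and> B \<in> sets (borel :: l1 measure)} \<subseteq> Pow (space M \<times> UNIV)"
      using pair_measure_closed[of "history n" "borel :: l1 measure"] by simp
    show "sets ?P1 = sigma_sets (space M \<times> UNIV) {C \<times> B | C B. C \<in> sets (history n) \<and> B \<in> sets (borel :: l1 measure)}"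
      "sets ?P2 = sigma_sets (space M \<times> UNIV) {C \<times> B | C B. C \<in> sets (history n) \<and> B \<in> sets (borel :: l1 measure)}"
      by (simp_all add: sets_pair_measure)
    show "range (\<lambda>_. space M \<times> UNIV) \<subseteq> {C \<times> B | C B. C \<in> sets (history n) \<and> B \<in> sets (borel :: l1 measure)}"
      by (intro image_subsetI CollectI exI[of _ "space M"] exI[of _ "UNIV :: l1 set"] conjI refl)
        (use sets.top[of "history n"] in simp_all)
    fix X assume "X \<in> {C \<times> B | C B. C \<in> sets (history n) \<and> B \<in> sets (borel :: l1 measure)}"
    then obtain C B where X: "X = C \<times> B" and C: "C \<in> sets (history n)" and B: "B \<in> sets (borel :: l1 measure)"
      by auto
    have CM: "C \<subseteq> space M" using sets.sets_into_space[OF C] by simp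
    have "emeasure ?P1 X = ennreal (A n) * emeasure M ((\<lambda>\<omega>. (\<omega>, U n \<omega>)) -` X \<inter> space M)"
      using m1 C B by (simp add: X emeasure_scale_measure emeasure_distr)
    also have "(\<lambda>\<omega>. (\<omega>, U n \<omega>)) -` X \<inter> space M = C \<inter> (U n -` B \<inter> space M)"
      using CM by (auto simp: X)
    also have "ennreal (A n) * emeasure M \<dots> = (\<integral>\<^sup>+ \<omega>. emeasure (tree_length n \<omega>) B * indicator C \<omega> \<partial>M)"
      by (rule emeasure_gluing_rectangle) fact+
    also have "\<dots> = (\<integral>\<^sup>+ \<omega>. \<integral>\<^sup>+ x. indicator X (\<omega>, x) \<partial>tree_length n \<omega> \<partial>M)"
      using B by (intro nn_integral_cong) (simp add: X indicator_times nn_integral_cmult mult.commute)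
    also have "\<dots> = emeasure ?P2 X"
      using C B by (subst P2[symmetric]) (auto simp: X)
    finally show "emeasure ?P1 X = emeasure ?P2 X" .
  next
    have "emeasure (distr M ?N (\<lambda>\<omega>. (\<omega>, U n \<omega>))) X < \<infinity>" for X
      using prob_space.emeasure_le_1[OF prob_space_distr[OF m1], of X]
      by (simp add: order_le_less_trans)
    then show "emeasure ?P1 (space M \<times> UNIV) \<noteq> \<infinity>"
      by (simp add: emeasure_scale_measure ennreal_mult_eq_top_iff less_top)
  qed auto
  then have "(\<integral>\<^sup>+ p. g p \<partial>?P1) = (\<integral>\<^sup>+ p. g p \<partial>?P2)" by simp
  moreover have "(\<integral>\<^sup>+ p. g p \<partial>?P1) = ennreal (A n) * (\<integral>\<^sup>+ \<omega>. g (\<omega>, U n \<omega>) \<partial>M)"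
    using g m1 by (simp add: nn_integral_scale_measure nn_integral_distr)
  ultimately show ?thesis
    using P2[OF g] by simp
qed

end

section \<open>Mean tails and mean number of close pairs\<close>

lemma branch_in_box:
  assumes "\<And>i. 1 \<le> i \<Longrightarrow> 0 \<le> a i" "1 \<le> i \<longrightarrow> u i \<in> box_l1 a i" "i < n" "t \<in> {0..a (Suc i)}"
  shows "branch u i t \<in> box_l1 a n"
proof -
  define z where "z = (if i = 0 then 0 else u i)"
  have z: "z \<in> box_l1 a i"
    using assms(2) by (auto simp: z_def box_l1_def)
  have c: "coord (branch u i t) k = coord z k + (if k = i then t else 0)" for k
    by (simp add: branch_def z_def)
  have zi: "coord z k = 0" if "i \<le> k" for k
    using z that by (simp add: box_l1_def)
  have zl: "0 \<le> coord z k \<and> coord z k \<le> a (Suc k)" if "k < i" for k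
    using z that by (simp add: box_l1_def)
  have "0 \<le> coord (branch u i t) k \<and> coord (branch u i t) k \<le> a (Suc k)" for k
    using zi[of k] zl[of k] assms(1)[of "Suc k"] assms(4) by (cases "k < i") (auto simp: c)
  moreover have "coord (branch u i t) k = 0" if "n \<le> k" for k
    using zi[of k] assms(3) that by (simp add: c)
  ultimately show ?thesis
    by (simp add: box_l1_def)
qed

lemma AE_length_measure_box:
  assumes "\<And>i. 1 \<le> i \<Longrightarrow> 0 \<le> a i" "\<And>i. 1 \<le> i \<Longrightarrow> i < n \<Longrightarrow> u i \<in> box_l1 a i"
  shows "AE x in length_measure a u n. x \<in> box_l1 a n"
  using AE_length_measure_finite_tree
proof eventually_elim
  case (elim x)
  then obtain i t where "i < n" "t \<in> {0..a (Suc i)}" "x = branch u i t"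
    unfolding finite_tree_eq by blast
  then show ?case
    using assms by (auto intro!: branch_in_box)
qed

lemma dist_add_unit:
  assumes "x \<in> box_l1 a n" "z \<in> box_l1 a n"
  shows "dist x (z + t *\<^sub>R unit_l1 n) = dist x z + \<bar>t\<bar>"
proof -
  have "coord (x - z) n = 0"
    using assms by (simp add: box_l1_def)
  from norm_add_unit[OF this, of "- t"] show ?thesis
    by (simp add: dist_norm diff_diff_eq)
qed

text \<open>A point \<open>z + t *\<^sub>R unit_l1 n\<close> of the new branch is at distance \<open>t\<close> from its gluing
  point \<open>z\<close>, so it is \<open>r\<close>-close to the old tree only if \<open>t \<le> r\<close>, and then only to points that are already
  \<open>r\<close>-close to \<open>z\<close>.\<close>
lemma close_pairs_length_measure_Suc:
  fixes a :: "nat \<Rightarrow> real" and u :: "nat \<Rightarrow> l1" and n :: nat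
  defines "z \<equiv> (if n = 0 then 0 else u n)"
  assumes a: "0 \<le> a (Suc n)" and r: "0 \<le> r"
    and z: "z \<in> box_l1 a n" and box: "AE x in length_measure a u n. x \<in> box_l1 a n"
  shows "close_pairs (length_measure a u (Suc n)) r \<le> close_pairs (length_measure a u n) r
    + 2 * (ennreal (min r (a (Suc n))) * (\<integral>\<^sup>+ y. indicator {..r} (dist z y) \<partial>length_measure a u n))
    + ennreal (2 * r * a (Suc n))"
proof -
  let ?L = "length_measure a u n" and ?a = "a (Suc n)"
  interpret finite_measure ?L by (rule finite_measure_length_measure)
  define k :: "l1 \<Rightarrow> l1 \<Rightarrow> ennreal" where "k x y = indicator {..r} (dist x y)" for x y
  have k [measurable]: "(\<lambda>p. k (fst p) (snd p)) \<in> borel_measurable (borel \<Otimes>\<^sub>M borel)"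
    unfolding k_def by measurable
  have k_meas [measurable]: "(\<lambda>x. k (f x) (g x)) \<in> borel_measurable N"
    if [measurable]: "f \<in> borel_measurable N" "g \<in> borel_measurable N" for f g and N :: "'b measure"
    unfolding k_def by measurable
  define b where "b t = z + t *\<^sub>R unit_l1 n" for t
  have b: "branch u n t = b t" for t
    by (simp add: b_def z_def branch_def)
  have b_meas [measurable]: "b \<in> borel_measurable borel"
    unfolding b_def [abs_def] by measurable
  define G where "G x = (\<integral>\<^sup>+ y. k x y \<partial>?L)" for x
  define H where "H x = (\<integral>\<^sup>+ t. k x (b t) * indicator {0..?a} t \<partial>lborel)" for x
  have [measurable]: "G \<in> borel_measurable borel" "H \<in> borel_measurable borel"
    unfolding G_def [abs_def] H_def [abs_def] by measurable
  have "(\<integral>\<^sup>+ y. k x y \<partial>length_measure a u (Suc n)) = G x + H x" for x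
    unfolding G_def H_def by (subst nn_integral_length_measure_Suc) (simp_all add: b)
  then have "close_pairs (length_measure a u (Suc n)) r = (\<integral>\<^sup>+ x. G x + H x \<partial>length_measure a u (Suc n))"
    by (simp add: close_pairs_def k_def)
  also have "\<dots> = (\<integral>\<^sup>+ x. G x + H x \<partial>?L) + (\<integral>\<^sup>+ t. (G (b t) + H (b t)) * indicator {0..?a} t \<partial>lborel)"
    by (subst nn_integral_length_measure_Suc) (simp_all add: b)
  also have "\<dots> = (\<integral>\<^sup>+ x. G x \<partial>?L) + (\<integral>\<^sup>+ x. H x \<partial>?L)
      + ((\<integral>\<^sup>+ t. G (b t) * indicator {0..?a} t \<partial>lborel) + (\<integral>\<^sup>+ t. H (b t) * indicator {0..?a} t \<partial>lborel))"
    by (simp add: nn_integral_add distrib_right)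
  also have "\<dots> \<le> (\<integral>\<^sup>+ x. G x \<partial>?L) + ennreal (min r ?a) * G z
      + (ennreal (min r ?a) * G z + ennreal (2 * r * ?a))"
  proof (intro add_mono order_refl)
    have k_b: "k x (b t) * indicator {0..?a} t \<le> k x z * indicator {0..min r ?a} t"
      if "x \<in> box_l1 a n" for x t
      using dist_add_unit[OF that z, of t] a r zero_le_dist[of x z]
      by (auto simp: k_def b_def indicator_def simp del: zero_le_dist)
    have "H x \<le> ennreal (min r ?a) * k z x" if "x \<in> box_l1 a n" for x
    proof -
      have "H x \<le> (\<integral>\<^sup>+ t. k x z * indicator {0..min r ?a} t \<partial>lborel)"
        unfolding H_def by (intro nn_integral_mono k_b that)
      also have "\<dots> = k x z * ennreal (min r ?a)"
        using a r by (subst nn_integral_cmult) simp_all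
      finally show ?thesis
        by (simp add: k_def dist_commute mult.commute)
    qed
    then have "(\<integral>\<^sup>+ x. H x \<partial>?L) \<le> (\<integral>\<^sup>+ x. ennreal (min r ?a) * k z x \<partial>?L)"
      using box by (intro nn_integral_mono_AE) auto
    also have "\<dots> = ennreal (min r ?a) * G z"
      unfolding G_def by (rule nn_integral_cmult) simp
    finally show "(\<integral>\<^sup>+ x. H x \<partial>?L) \<le> ennreal (min r ?a) * G z" .
    have "G (b t) * indicator {0..?a} t \<le> G z * indicator {0..min r ?a} t" for t
    proof -
      have "G (b t) * indicator {0..?a} t = (\<integral>\<^sup>+ y. k y (b t) * indicator {0..?a} t \<partial>?L)"
        unfolding G_def by (subst nn_integral_multc[symmetric]) (simp_all add: k_def dist_commute)
      also have "\<dots> \<le> (\<integral>\<^sup>+ y. k y z * indicator {0..min r ?a} t \<partial>?L)"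
        using box by (intro nn_integral_mono_AE) (auto intro: k_b)
      also have "\<dots> = G z * indicator {0..min r ?a} t"
        unfolding G_def by (subst nn_integral_multc[symmetric]) (simp_all add: k_def dist_commute)
      finally show ?thesis .
    qed
    then have "(\<integral>\<^sup>+ t. G (b t) * indicator {0..?a} t \<partial>lborel) \<le> (\<integral>\<^sup>+ t. G z * indicator {0..min r ?a} t \<partial>lborel)"
      by (rule nn_integral_mono)
    also have "\<dots> = ennreal (min r ?a) * G z"
      using a r by (subst nn_integral_cmult) (simp_all add: mult.commute)
    finally show "(\<integral>\<^sup>+ t. G (b t) * indicator {0..?a} t \<partial>lborel) \<le> ennreal (min r ?a) * G z" .
    have H_b: "H (b t) \<le> ennreal (2 * r)" for t
    proof -
      have "dist (b t) (b t') = \<bar>t - t'\<bar>" for t'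
        by (simp add: b_def dist_norm flip: scaleR_diff_left)
      then have "H (b t) \<le> (\<integral>\<^sup>+ t'. indicator {t - r..t + r} t' \<partial>lborel)"
        unfolding H_def k_def by (intro nn_integral_mono) (auto simp: indicator_def)
      also have "\<dots> = ennreal (2 * r)"
        using r by simp
      finally show ?thesis .
    qed
    have "(\<integral>\<^sup>+ t. H (b t) * indicator {0..?a} t \<partial>lborel) \<le> (\<integral>\<^sup>+ t. ennreal (2 * r) * indicator {0..?a} t \<partial>lborel)"
      by (intro nn_integral_mono mult_right_mono H_b) simp
    also have "\<dots> = ennreal (2 * r * ?a)"
      using a r by (subst nn_integral_cmult) (simp_all add: ennreal_mult)
    finally show "(\<integral>\<^sup>+ t. H (b t) * indicator {0..?a} t \<partial>lborel) \<le> ennreal (2 * r * ?a)" .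
  qed
  also have "(\<integral>\<^sup>+ x. G x \<partial>?L) + ennreal (min r ?a) * G z + (ennreal (min r ?a) * G z + ennreal (2 * r * ?a))
      = (\<integral>\<^sup>+ x. G x \<partial>?L) + 2 * (ennreal (min r ?a) * G z) + ennreal (2 * r * ?a)"
    by (simp only: mult_2 add.assoc)
  finally show ?thesis
    by (simp only: close_pairs_def k_def G_def)
qed

context aggregation
begin

text \<open>Conditional uniformity puts each gluing point on the tree built so far, which lies in its box as soon as the
  earlier gluing points lie in theirs.\<close>
lemma AE_U_box: "AE \<omega> in M. \<forall>n\<ge>1. U n \<omega> \<in> box_l1 a n"
proof -
  have "1 \<le> n \<longrightarrow> (AE \<omega> in M. U n \<omega> \<in> box_l1 a n)" for n
  proof (induction n rule: less_induct)
    case (less n)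
    show ?case
    proof
      assume n: "1 \<le> n"
      note [measurable] = measurable_U[OF n]
      have [measurable]: "box_l1 a n \<in> sets borel"
        by (intro borel_closed closed_box_l1)
      have "AE \<omega> in M. \<forall>i\<in>{1..<n}. U i \<omega> \<in> box_l1 a i"
        by (rule AE_finite_allI) (use less in auto)
      then have "AE \<omega> in M. (\<integral>\<^sup>+ x. indicator (- box_l1 a n) x \<partial>tree_length n \<omega>) = 0"
      proof eventually_elim
        case (elim \<omega>)
        then have "AE x in tree_length n \<omega>. x \<in> box_l1 a n"
          by (intro AE_length_measure_box) (auto simp: a_nonneg)
        then show ?case
          by (subst nn_integral_0_iff_AE) auto
      qed
      then have "(\<integral>\<^sup>+ \<omega>. \<integral>\<^sup>+ x. indicator (- box_l1 a n) x \<partial>tree_length n \<omega> \<partial>M) = 0"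
        by (subst nn_integral_cong_AE[where v = "\<lambda>_. 0"]) auto
      then have "ennreal (A n) * (\<integral>\<^sup>+ \<omega>. indicator (- box_l1 a n) (U n \<omega>) \<partial>M) = 0"
        using nn_integral_gluing[OF n, of "\<lambda>p. indicator (- box_l1 a n) (snd p)"] by simp
      then have "(\<integral>\<^sup>+ \<omega>. indicator (- box_l1 a n) (U n \<omega>) \<partial>M) = 0"
        using A_pos[OF n] by simp
      then show "AE \<omega> in M. U n \<omega> \<in> box_l1 a n"
        by (subst (asm) nn_integral_0_iff_AE) (auto simp: indicator_def)
    qed
  qed
  then have "AE \<omega> in M. 1 \<le> n \<longrightarrow> U n \<omega> \<in> box_l1 a n" for n
    by (cases "1 \<le> n") auto
  then show ?thesis
    by (simp add: AE_all_countable)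
qed

lemma AE_tree_length_box: "AE \<omega> in M. AE x in tree_length n \<omega>. x \<in> box_l1 a n"
  using AE_U_box by eventually_elim (intro AE_length_measure_box, auto simp: a_nonneg)

lemma measurable_nn_integral_tree_length [measurable]:
  "f \<in> borel_measurable borel \<Longrightarrow> (\<lambda>\<omega>. \<integral>\<^sup>+ x. f x \<partial>tree_length n \<omega>) \<in> borel_measurable M"
  using measurable_nn_integral_length_measure[of "\<lambda>p. f (snd p)" M n U a] by simp

lemma measurable_close_to:
  assumes "\<And>i. 1 \<le> i \<Longrightarrow> i < n \<Longrightarrow> U i \<in> borel_measurable N"
  shows "(\<lambda>p. \<integral>\<^sup>+ y. indicator {..r} (dist (snd p) y) \<partial>tree_length n (fst p)) \<in> borel_measurable (N \<Otimes>\<^sub>M borel)"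
proof -
  have "(\<lambda>q. indicator {..r} (dist (snd (fst q)) (snd q)) :: ennreal)
      \<in> borel_measurable ((N \<Otimes>\<^sub>M borel) \<Otimes>\<^sub>M (borel :: l1 measure))"
    by measurable
  from measurable_nn_integral_length_measure[OF this, of n "\<lambda>i p. U i (fst p)" a]
  show ?thesis
    using assms by (simp add: measurable_compose[OF measurable_fst])
qed

lemma measurable_close_pairs [measurable]: "(\<lambda>\<omega>. close_pairs (tree_length n \<omega>) r) \<in> borel_measurable M"
  using measurable_nn_integral_length_measure[OF measurable_close_to[of n M r], of n U a] measurable_U
  by (simp add: close_pairs_def)

text \<open>Given the history, the new branch carries on average at most \<open>a (Suc n)\<close> times the mean tail of the
  old tree plus \<open>(a (Suc n))\<^sup>2\<close>: after normalization the mean tail increases by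
  at most the general term of the series that is assumed to converge.\<close>
lemma mean_tail_norm_le:
  assumes k: "1 \<le> k"
  shows "(\<integral>\<^sup>+ \<omega>. \<integral>\<^sup>+ x. ennreal (tail_norm k x) \<partial>tree_length n \<omega> \<partial>M)
    \<le> ennreal (A n * (\<Sum>i\<in>{k<..n}. (a i)\<^sup>2 / A i))"
proof (induction n)
  case 0
  have "(\<integral>\<^sup>+ x. ennreal (tail_norm k x) \<partial>tree_length 0 \<omega>) = 0" for \<omega>
    using continuous_on_tail_norm[of UNIV k]
    by (subst nn_integral_length_measure) (auto intro: borel_measurable_continuous_onI)
  then show ?case by simp
next
  case (Suc n)
  have [measurable]: "tail_norm k \<in> borel_measurable borel"
    by (intro borel_measurable_continuous_onI continuous_on_tail_norm)
  show ?case
  proof (cases "n < k")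
    case True
    have "AE \<omega> in M. (\<integral>\<^sup>+ x. ennreal (tail_norm k x) \<partial>tree_length (Suc n) \<omega>) = 0"
      using AE_tree_length_box[of "Suc n"]
    proof eventually_elim
      case (elim \<omega>)
      have "tail_norm k x = 0" if "x \<in> box_l1 a (Suc n)" for x
        using that True by (intro tail_norm_eq_0) (auto simp: box_l1_def)
      with elim show ?case
        by (subst nn_integral_0_iff_AE) auto
    qed
    then have "(\<integral>\<^sup>+ \<omega>. \<integral>\<^sup>+ x. ennreal (tail_norm k x) \<partial>tree_length (Suc n) \<omega> \<partial>M) = 0"
      by (subst nn_integral_cong_AE[where v = "\<lambda>_. 0"]) auto
    then show ?thesis by simp
  next
    case False
    then have n: "1 \<le> n" using k by simp
    note [measurable] = measurable_U[OF n]
    define S where "S = (\<Sum>i\<in>{k<..n}. (a i)\<^sup>2 / A i)"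
    have S: "0 \<le> S" unfolding S_def using A_nonneg by (intro sum_nonneg) auto
    let ?a = "a (Suc n)"
    have a: "0 \<le> ?a" by (rule a_nonneg) simp
    have "ennreal (A n) * (\<integral>\<^sup>+ \<omega>. ennreal (tail_norm k (U n \<omega>)) \<partial>M) \<le> ennreal (A n) * ennreal S"
      using nn_integral_gluing[OF n, of "\<lambda>p. ennreal (tail_norm k (snd p))"] Suc.IH S A_nonneg[of n]
      by (simp add: S_def ennreal_mult)
    then have U: "(\<integral>\<^sup>+ \<omega>. ennreal (tail_norm k (U n \<omega>)) \<partial>M) \<le> ennreal S"
      using A_pos[OF n] by (subst (asm) ennreal_mult_le_mult_iff) auto
    have "(\<integral>\<^sup>+ x. ennreal (tail_norm k x) \<partial>tree_length (Suc n) \<omega>)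
        \<le> (\<integral>\<^sup>+ x. ennreal (tail_norm k x) \<partial>tree_length n \<omega>)
          + (ennreal (tail_norm k (U n \<omega>)) * ennreal ?a + ennreal (?a\<^sup>2))" for \<omega>
    proof -
      have "(\<integral>\<^sup>+ t. ennreal (tail_norm k (branch (\<lambda>i. U i \<omega>) n t)) * indicator {0..?a} t \<partial>lborel)
          \<le> (\<integral>\<^sup>+ t. ennreal (tail_norm k (U n \<omega>) + ?a) * indicator {0..?a} t \<partial>lborel)"
      proof (intro nn_integral_mono)
        fix t
        show "ennreal (tail_norm k (branch (\<lambda>i. U i \<omega>) n t)) * indicator {0..?a} t
            \<le> ennreal (tail_norm k (U n \<omega>) + ?a) * indicator {0..?a} t"
          using tail_norm_add_unit_le[of k "U n \<omega>" t n] n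
          by (auto simp: branch_def indicator_def simp del: ennreal_plus intro!: ennreal_leI)
      qed
      also have "\<dots> = ennreal (tail_norm k (U n \<omega>)) * ennreal ?a + ennreal (?a\<^sup>2)"
        using a by (subst nn_integral_cmult)
          (simp_all add: power2_eq_square distrib_right flip: ennreal_mult ennreal_plus)
      finally show ?thesis
        by (subst nn_integral_length_measure_Suc) (auto intro: add_left_mono)
    qed
    then have "(\<integral>\<^sup>+ \<omega>. \<integral>\<^sup>+ x. ennreal (tail_norm k x) \<partial>tree_length (Suc n) \<omega> \<partial>M)
        \<le> (\<integral>\<^sup>+ \<omega>. (\<integral>\<^sup>+ x. ennreal (tail_norm k x) \<partial>tree_length n \<omega>)
          + (ennreal (tail_norm k (U n \<omega>)) * ennreal ?a + ennreal (?a\<^sup>2)) \<partial>M)"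
      by (intro nn_integral_mono)
    also have "\<dots> = (\<integral>\<^sup>+ \<omega>. \<integral>\<^sup>+ x. ennreal (tail_norm k x) \<partial>tree_length n \<omega> \<partial>M)
        + ((\<integral>\<^sup>+ \<omega>. ennreal (tail_norm k (U n \<omega>)) \<partial>M) * ennreal ?a + ennreal (?a\<^sup>2))"
      by (simp add: nn_integral_add nn_integral_multc emeasure_space_1)
    also have "\<dots> \<le> ennreal (A n * S) + (ennreal S * ennreal ?a + ennreal (?a\<^sup>2))"
      using Suc.IH U by (intro add_mono mult_right_mono order_refl) (auto simp: S_def)
    also have "\<dots> = ennreal (A (Suc n) * S + ?a\<^sup>2)"
      using S a A_nonneg[of n] by (simp add: distrib_right distrib_left mult.commute flip: ennreal_mult ennreal_plus)
    also have "A (Suc n) * S + ?a\<^sup>2 = A (Suc n) * (S + ?a\<^sup>2 / A (Suc n))"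
      using A_pos[of "Suc n"] by (simp add: distrib_left del: partial_sum_Suc)
    also have "S + ?a\<^sup>2 / A (Suc n) = (\<Sum>i\<in>{k<..Suc n}. (a i)\<^sup>2 / A i)"
    proof -
      have "{k<..Suc n} = insert (Suc n) {k<..n}" using False by auto
      then show ?thesis by (simp add: S_def del: partial_sum_Suc)
    qed
    finally show ?thesis .
  qed
qed

text \<open>The gain in one step involves the length of the set of points close to the gluing point \<open>U n\<close>. As \<open>U n\<close> is
  uniform given the history, the mean of this length is the mean of the close pairs divided by \<open>A n\<close>, which
  closes the recursion.\<close>
lemma mean_close_pairs_Suc:
  assumes n: "1 \<le> n" and r: "0 \<le> r" and c: "0 \<le> c"
    and IH: "(\<integral>\<^sup>+ \<omega>. close_pairs (tree_length n \<omega>) r \<partial>M) \<le> ennreal (A n * c)"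
  shows "(\<integral>\<^sup>+ \<omega>. close_pairs (tree_length (Suc n) \<omega>) r \<partial>M)
    \<le> ennreal (A n * c + 2 * min r (a (Suc n)) * c + 2 * r * a (Suc n))"
proof -
  let ?a = "a (Suc n)"
  define g where "g p = (\<integral>\<^sup>+ y. indicator {..r} (dist (snd p) y) \<partial>tree_length n (fst p))" for p :: "'w \<times> l1"
  have a: "0 \<le> ?a" by (rule a_nonneg) simp
  have g: "g \<in> borel_measurable (history n \<Otimes>\<^sub>M borel)"
    unfolding g_def [abs_def] by (intro measurable_close_to measurable_U_history)
  have "g \<in> borel_measurable (M \<Otimes>\<^sub>M borel)"
    unfolding g_def [abs_def] by (intro measurable_close_to measurable_U)
  then have gU [measurable]: "(\<lambda>\<omega>. g (\<omega>, U n \<omega>)) \<in> borel_measurable M"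
    using measurable_U[OF n] by (intro measurable_compose[of "\<lambda>\<omega>. (\<omega>, U n \<omega>)" M "M \<Otimes>\<^sub>M borel" g]) auto
  have "ennreal (A n) * (\<integral>\<^sup>+ \<omega>. g (\<omega>, U n \<omega>) \<partial>M) = (\<integral>\<^sup>+ \<omega>. close_pairs (tree_length n \<omega>) r \<partial>M)"
    unfolding nn_integral_gluing[OF n g] by (simp add: g_def close_pairs_def)
  also have "\<dots> \<le> ennreal (A n) * ennreal c"
    using IH c A_nonneg[of n] by (simp add: ennreal_mult)
  finally have gc: "(\<integral>\<^sup>+ \<omega>. g (\<omega>, U n \<omega>) \<partial>M) \<le> ennreal c"
    using A_pos[OF n] by (subst (asm) ennreal_mult_le_mult_iff) auto
  have "(\<integral>\<^sup>+ \<omega>. close_pairs (tree_length (Suc n) \<omega>) r \<partial>M)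
      \<le> (\<integral>\<^sup>+ \<omega>. close_pairs (tree_length n \<omega>) r + 2 * (ennreal (min r ?a) * g (\<omega>, U n \<omega>))
        + ennreal (2 * r * ?a) \<partial>M)"
  proof (rule nn_integral_mono_AE)
    show "AE \<omega> in M. close_pairs (tree_length (Suc n) \<omega>) r
      \<le> close_pairs (tree_length n \<omega>) r + 2 * (ennreal (min r ?a) * g (\<omega>, U n \<omega>)) + ennreal (2 * r * ?a)"
      using AE_U_box AE_tree_length_box[of n]
    proof eventually_elim
      case (elim \<omega>)
      then show ?case
        using close_pairs_length_measure_Suc[of a n r "\<lambda>i. U i \<omega>"] a r n by (simp add: g_def)
    qed
  qed
  also have "\<dots> = (\<integral>\<^sup>+ \<omega>. close_pairs (tree_length n \<omega>) r \<partial>M)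
      + 2 * (ennreal (min r ?a) * (\<integral>\<^sup>+ \<omega>. g (\<omega>, U n \<omega>) \<partial>M)) + ennreal (2 * r * ?a)"
    by (simp add: nn_integral_add nn_integral_cmult emeasure_space_1)
  also have "\<dots> \<le> ennreal (A n * c) + 2 * (ennreal (min r ?a) * ennreal c) + ennreal (2 * r * ?a)"
    using IH gc by (intro add_mono mult_left_mono order_refl) auto
  also have "\<dots> = ennreal (A n * c + 2 * min r ?a * c + 2 * r * ?a)"
  proof -
    have "2 * (ennreal (min r ?a) * ennreal c) = ennreal (2 * min r ?a * c)"
      using a r c by (simp add: ennreal_mult mult.assoc flip: ennreal_numeral)
    moreover have "0 \<le> 2 * min r ?a * c" "0 \<le> A n * c" "0 \<le> 2 * r * ?a"
      using a r c A_nonneg[of n] by auto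
    ultimately show ?thesis by (simp only: ennreal_plus add_nonneg_nonneg)
  qed
  finally show ?thesis .
qed

text \<open>As long as \<open>r * (1 / A 1 + \<dots> + 1 / A n)\<close> stays bounded, the recursion with \<open>min r (a (Suc n)) \<le> r\<close>
  keeps the mean measure of the close pairs of order \<open>r * A n\<close>, the order of the bound
  \<open>2 * r * (a 1 + \<dots> + a n)\<close> for the pairs on a common branch.\<close>
lemma mean_close_pairs_le_initial:
  assumes r: "0 \<le> r" and n: "1 \<le> n"
  shows "(\<integral>\<^sup>+ \<omega>. close_pairs (tree_length n \<omega>) r \<partial>M)
    \<le> ennreal (A n * (2 * r * exp (2 * r * (\<Sum>m\<in>{1..<n}. 1 / A m))))"
  using n
proof (induction n rule: nat_induct_at_least)
  case base
  have a: "0 \<le> a (Suc 0)" by (rule a_nonneg) simp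
  have "close_pairs (tree_length 1 \<omega>) r \<le> ennreal (2 * r * a (Suc 0))" for \<omega>
  proof -
    have "AE x in tree_length 0 \<omega>. x \<in> box_l1 a 0"
      by (rule AE_length_measure_box) (auto simp: a_nonneg)
    then have "close_pairs (tree_length (Suc 0) \<omega>) r \<le> close_pairs (tree_length 0 \<omega>) r
        + 2 * (ennreal (min r (a (Suc 0))) * (\<integral>\<^sup>+ y. indicator {..r} (dist 0 y) \<partial>tree_length 0 \<omega>))
        + ennreal (2 * r * a (Suc 0))"
      using close_pairs_length_measure_Suc[of a 0 r "\<lambda>i. U i \<omega>"] a r by (simp add: box_l1_def)
    moreover have "(\<integral>\<^sup>+ y. f y \<partial>tree_length 0 \<omega>) = 0" if "f \<in> borel_measurable borel" for f
      using that by (simp add: nn_integral_length_measure)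
    ultimately show ?thesis by (simp add: close_pairs_def)
  qed
  then have "(\<integral>\<^sup>+ \<omega>. close_pairs (tree_length 1 \<omega>) r \<partial>M) \<le> (\<integral>\<^sup>+ \<omega>. ennreal (2 * r * a (Suc 0)) \<partial>M)"
    by (intro nn_integral_mono)
  then show ?case
    by (simp add: emeasure_space_1 mult.commute)
next
  case (Suc n)
  let ?a = "a (Suc n)"
  define E where "E = exp (2 * r * (\<Sum>m\<in>{1..<n}. 1 / A m))"
  define E' where "E' = exp (2 * r * (\<Sum>m\<in>{1..<Suc n}. 1 / A m))"
  have a: "0 \<le> ?a" by (rule a_nonneg) simp
  have An: "0 < A n" using Suc.hyps by (rule A_pos)
  have E_step: "E * (1 + 2 * r / A n) \<le> E'"
  proof -
    have "E' = E * exp (2 * r / A n)"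
      using Suc.hyps unfolding E_def E'_def
      by (simp add: sum.atLeastLessThan_Suc distrib_left exp_add)
    moreover have "1 + 2 * r / A n \<le> exp (2 * r / A n)"
      by (rule exp_ge_add_one_self)
    ultimately show ?thesis
      by (simp add: E_def)
  qed
  have "0 \<le> (\<Sum>m\<in>{1..<Suc n}. 1 / A m)"
    by (intro sum_nonneg) (simp add: A_nonneg)
  then have "1 \<le> E'"
    unfolding E'_def using r by (simp del: sum.op_ivl_Suc)
  have "(\<integral>\<^sup>+ \<omega>. close_pairs (tree_length (Suc n) \<omega>) r \<partial>M)
      \<le> ennreal (A n * (2 * r * E) + 2 * min r ?a * (2 * r * E) + 2 * r * ?a)"
    by (rule mean_close_pairs_Suc) (use Suc r in \<open>auto simp: E_def\<close>)
  also have "\<dots> \<le> ennreal (A (Suc n) * (2 * r * E'))"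
  proof (rule ennreal_leI)
    have "A n * (2 * r * E) + 2 * min r ?a * (2 * r * E) \<le> A n * (2 * r * E) + 2 * r * (2 * r * E)"
      using r by (intro add_left_mono mult_right_mono mult_left_mono) (auto simp: E_def)
    also have "\<dots> = A n * (2 * r) * (E * (1 + 2 * r / A n))"
      using An by (simp add: field_simps)
    also have "\<dots> \<le> A n * (2 * r) * E'"
      using E_step An r by (intro mult_left_mono) auto
    finally have "A n * (2 * r * E) + 2 * min r ?a * (2 * r * E) \<le> A n * (2 * r) * E'" .
    moreover have "2 * r * ?a * 1 \<le> 2 * r * ?a * E'"
      using \<open>1 \<le> E'\<close> r a by (intro mult_left_mono) auto
    ultimately show "A n * (2 * r * E) + 2 * min r ?a * (2 * r * E) + 2 * r * ?a \<le> A (Suc n) * (2 * r * E')"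
      by (simp add: algebra_simps)
  qed
  finally show ?case by (simp only: E'_def)
qed

text \<open>Past the time \<open>k\<close>, the bound \<open>min r (a (Suc n)) \<le> a (Suc n)\<close> is used instead: the normalized
  mean then increases by at most \<open>2 * r * a (Suc n) / (A (Suc n))\<^sup>2\<close>, which is dominated by a telescoping series.\<close>
lemma mean_close_pairs_le:
  assumes r: "0 \<le> r" and k: "1 \<le> k" and n: "k \<le> n"
  shows "(\<integral>\<^sup>+ \<omega>. close_pairs (tree_length n \<omega>) r \<partial>M)
    \<le> ennreal ((A n)\<^sup>2 * (4 * r * exp (2 * r * (\<Sum>m\<in>{1..<k}. 1 / A m)) / A k))"
proof -
  define C where "C = exp (2 * r * (\<Sum>m\<in>{1..<k}. 1 / A m))"
  have C: "1 \<le> C"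
    unfolding C_def using r A_nonneg by (auto intro!: mult_nonneg_nonneg sum_nonneg)
  have Ak: "0 < A k" using k by (rule A_pos)
  define X where "X n = 2 * r * C / A k + 2 * r * (1 / A k - 1 / A n)" for n
  have A_mono: "A k \<le> A n" if "k \<le> n" for n
    using that by (induction n rule: nat_induct_at_least) (auto simp: a_nonneg add_increasing2)
  have X_nonneg: "0 \<le> X n" if "k \<le> n" for n
    using A_mono[OF that] Ak r C by (auto simp: X_def intro!: add_nonneg_nonneg mult_nonneg_nonneg frac_le)
  have "(\<integral>\<^sup>+ \<omega>. close_pairs (tree_length n \<omega>) r \<partial>M) \<le> ennreal ((A n)\<^sup>2 * X n)"
    using n
  proof (induction n rule: nat_induct_at_least)
    case base
    show ?case
      using mean_close_pairs_le_initial[OF r k] Ak by (simp add: X_def C_def power2_eq_square mult.assoc)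
  next
    case (Suc n)
    let ?a = "a (Suc n)"
    have a: "0 \<le> ?a" by (rule a_nonneg) simp
    have An: "0 < A n" using Suc.hyps k by (intro A_pos) simp
    have As: "A (Suc n) = A n + ?a" by simp
    have "(\<integral>\<^sup>+ \<omega>. close_pairs (tree_length (Suc n) \<omega>) r \<partial>M)
        \<le> ennreal (A n * (A n * X n) + 2 * min r ?a * (A n * X n) + 2 * r * ?a)"
      by (rule mean_close_pairs_Suc)
        (use Suc k r An X_nonneg[of n] in \<open>auto simp: power2_eq_square mult.assoc\<close>)
    also have "\<dots> \<le> ennreal ((A (Suc n))\<^sup>2 * X (Suc n))"
    proof (rule ennreal_leI)
      have "A n * (A n * X n) + 2 * min r ?a * (A n * X n) \<le> A n * (A n * X n) + 2 * ?a * (A n * X n)"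
        using An X_nonneg[OF Suc.hyps] by (intro add_left_mono mult_right_mono) auto
      also have "\<dots> \<le> (A (Suc n))\<^sup>2 * X n"
        using X_nonneg[OF Suc.hyps] unfolding As
        by (simp add: power2_eq_square algebra_simps)
      finally have "A n * (A n * X n) + 2 * min r ?a * (A n * X n) \<le> (A (Suc n))\<^sup>2 * X n" .
      moreover have "2 * r * ?a \<le> (A (Suc n))\<^sup>2 * (2 * r * (1 / A n - 1 / A (Suc n)))"
      proof -
        have As0: "0 < A n + ?a" using An a by simp
        have "(A (Suc n))\<^sup>2 * (2 * r * (1 / A n - 1 / A (Suc n))) = 2 * r * ?a * ((A n + ?a) / A n)"
          using An As0 unfolding As by (simp add: divide_simps power2_eq_square)
        moreover have "2 * r * ?a * 1 \<le> 2 * r * ?a * ((A n + ?a) / A n)"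
          using An a r by (intro mult_left_mono) auto
        ultimately show ?thesis by simp
      qed
      moreover have "X (Suc n) = X n + 2 * r * (1 / A n - 1 / A (Suc n))"
        by (simp add: X_def right_diff_distrib del: partial_sum_Suc)
      ultimately show "A n * (A n * X n) + 2 * min r ?a * (A n * X n) + 2 * r * ?a \<le> (A (Suc n))\<^sup>2 * X (Suc n)"
        by (simp only: distrib_left add_mono)
    qed
    finally show ?case .
  qed
  also have "\<dots> \<le> ennreal ((A n)\<^sup>2 * (4 * r * C / A k))"
  proof (intro ennreal_leI mult_left_mono)
    have "X n \<le> 2 * r * C / A k + 2 * r * (1 / A k)"
      unfolding X_def using r A_nonneg[of n] by (intro add_left_mono mult_left_mono) auto
    also have "2 * r * (1 / A k) \<le> 2 * r * (C / A k)"
      using r C Ak by (intro mult_left_mono divide_right_mono) auto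
    finally show "X n \<le> 4 * r * C / A k" by (simp add: mult.commute mult.left_commute)
  qed simp
  finally show ?thesis by (simp only: C_def)
qed

end

section \<open>Energy and tightness of the uniform measures\<close>

lemma sum_powr_le:
  fixes p :: real
  assumes p: "0 < p" "p \<le> 1"
  shows "(\<Sum>m\<in>{1..k}. real m powr (p - 1)) \<le> real k powr p / p"
proof (induction k)
  case 0
  then show ?case by simp
next
  case (Suc k)
  have "p * real (Suc k) powr (p - 1) \<le> real (Suc k) powr p - real k powr p"
  proof (cases "k = 0")
    case True
    then show ?thesis using p by simp
  next
    case False
    have "\<exists>z. real k < z \<and> z < real (Suc k) \<and>
        real (Suc k) powr p - real k powr p = (real (Suc k) - real k) * (p * z powr (p - 1))"
      using False by (intro MVT2) (auto intro!: derivative_eq_intros)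
    then obtain z where z: "real k < z" "z < real (Suc k)"
      "real (Suc k) powr p - real k powr p = p * z powr (p - 1)"
      by auto
    have "real (Suc k) powr (p - 1) \<le> z powr (p - 1)"
      using z p by (intro powr_mono2') auto
    then show ?thesis using z p by simp
  qed
  then have "real (Suc k) powr (p - 1) \<le> (real (Suc k) powr p - real k powr p) / p"
    using p by (simp add: pos_le_divide_eq mult.commute)
  then show ?case
    using Suc by (simp add: diff_divide_distrib)
qed

lemma (in prob_space) AE_I_arbitrarily_small:
  assumes "\<And>\<delta>. 0 < \<delta> \<Longrightarrow> \<exists>N\<in>sets M. emeasure M N \<le> ennreal \<delta> \<and> (\<forall>\<omega>\<in>space M - N. P \<omega>)"
  shows "AE \<omega> in M. P \<omega>"
proof -
  have "\<exists>N\<in>sets M. emeasure M N \<le> ennreal (inverse (real (Suc m))) \<and> (\<forall>\<omega>\<in>space M - N. P \<omega>)" for m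
    by (rule assms) simp
  then obtain N where N: "\<And>m. N m \<in> sets M" "\<And>m. emeasure M (N m) \<le> ennreal (inverse (real (Suc m)))"
    "\<And>m \<omega>. \<omega> \<in> space M - N m \<Longrightarrow> P \<omega>"
    by metis
  have [measurable]: "(\<Inter>m. N m) \<in> sets M" using N(1) by auto
  have "emeasure M (\<Inter>m. N m) \<le> ennreal (inverse (real (Suc m)))" for m
    using N(2)[of m] emeasure_mono[of "\<Inter>m. N m" "N m" M] N(1) by (meson INT_lower UNIV_I order_trans)
  moreover have "(\<lambda>m. ennreal (inverse (real (Suc m)))) \<longlonglongrightarrow> ennreal 0"
    by (intro tendsto_ennrealI LIMSEQ_inverse_real_of_nat)
  ultimately have "emeasure M (\<Inter>m. N m) \<le> ennreal 0"
    by (intro LIMSEQ_le_const) auto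
  then have "emeasure M (\<Inter>m. N m) = 0" by simp
  moreover have "{\<omega>\<in>space M. \<not> P \<omega>} \<subseteq> (\<Inter>m. N m)"
    using N(3) by blast
  ultimately show ?thesis
    by (intro AE_I[where N = "\<Inter>m. N m"]) auto
qed

context aggregation
begin

abbreviation "tree_prob n \<omega> \<equiv> uniform_on_tree a (\<lambda>i. U i \<omega>) n"

lemma prob_space_tree_prob: "1 \<le> n \<Longrightarrow> prob_space (tree_prob n \<omega>)"
  by (rule prob_space_uniform_on_tree) (use a_nonneg A_pos in auto)

lemma nn_integral_tree_prob:
  "f \<in> borel_measurable borel \<Longrightarrow> (\<integral>\<^sup>+ x. f x \<partial>tree_prob n \<omega>) = (\<integral>\<^sup>+ x. f x \<partial>tree_length n \<omega>) / ennreal (A n)"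
  by (rule nn_integral_uniform_on_tree) (auto simp: a_nonneg)

lemma AE_tree_prob: "AE x in tree_prob n \<omega>. x \<in> aggregation_tree a (\<lambda>i. U i \<omega>)"
  unfolding uniform_on_tree_def
proof (rule AE_uniform_measureI)
  show "finite_tree a (\<lambda>i. U i \<omega>) n \<in> sets (tree_length n \<omega>)"
    by (simp add: borel_closed closed_finite_tree)
  have "finite_tree a (\<lambda>i. U i \<omega>) n \<subseteq> aggregation_tree a (\<lambda>i. U i \<omega>)"
    unfolding aggregation_tree_def by (rule order_trans[OF UN_upper closure_subset]) simp
  then show "AE x in tree_length n \<omega>. x \<in> finite_tree a (\<lambda>i. U i \<omega>) n \<longrightarrow> x \<in> aggregation_tree a (\<lambda>i. U i \<omega>)"
    by (intro AE_I2) auto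
qed

lemma close_pairs_tree_prob:
  "close_pairs (tree_prob n \<omega>) r = close_pairs (tree_length n \<omega>) r / ennreal (A n) / ennreal (A n)"
proof -
  interpret L: finite_measure "tree_length n \<omega>" by (rule finite_measure_length_measure)
  have k [measurable]: "(\<lambda>y. indicator {..r} (dist x y) :: ennreal) \<in> borel_measurable borel" for x :: l1
    by measurable
  have [measurable]: "(\<lambda>x. \<integral>\<^sup>+ y. indicator {..r} (dist x y) \<partial>tree_length n \<omega>) \<in> borel_measurable borel"
    by measurable
  show ?thesis
    unfolding close_pairs_def
    by (simp add: nn_integral_tree_prob nn_integral_divide)
qed

lemma power_lower_bound_A:
  assumes "\<forall>\<^sub>F n in sequentially. real n powr \<beta> \<le> A n" and \<beta>: "0 \<le> \<beta>"
  shows "\<exists>c>0. \<forall>n\<ge>1. c * real n powr \<beta> \<le> A n"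
proof -
  obtain N where N: "\<And>n. N \<le> n \<Longrightarrow> real n powr \<beta> \<le> A n"
    using assms(1) by (auto simp: eventually_sequentially)
  define c where "c = min 1 (A 1 / real (Suc N) powr \<beta>)"
  have A1: "0 < A 1" by (rule A_pos) simp
  have "0 < c" using A1 by (simp add: c_def)
  moreover have "c * real n powr \<beta> \<le> A n" if n: "1 \<le> n" for n
  proof (cases "N \<le> n")
    case True
    have "c * real n powr \<beta> \<le> 1 * real n powr \<beta>"
      by (intro mult_right_mono) (auto simp: c_def)
    then show ?thesis using N[OF True] by simp
  next
    case False
    have "c * real n powr \<beta> \<le> (A 1 / real (Suc N) powr \<beta>) * real (Suc N) powr \<beta>"
      using False A1 \<beta> \<open>0 < c\<close> by (intro mult_mono powr_mono2) (auto simp: c_def)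
    also have "\<dots> = A 1" by simp
    also have "A 1 \<le> A n"
      using n by (induction n rule: nat_induct_at_least) (auto simp: a_nonneg add_increasing2)
    finally show ?thesis .
  qed
  ultimately show ?thesis by blast
qed

text \<open>The scale \<open>r\<close> is resolved by the first \<open>k\<close> branches, where \<open>k\<close> is about \<open>r powr (- 1 / p)\<close>: up to this order the
  assumed growth of \<open>A\<close> keeps \<open>r * (1 / A 1 + \<dots> + 1 / A k)\<close> bounded. The resulting bound \<open>r / A k\<close> on the probability of
  a close pair is at most of order \<open>r * r powr ((1 - p) / p) = r powr (1 / p)\<close>.\<close>
lemma close_pairs_power_bound:
  assumes c: "0 < c" "\<And>n. 1 \<le> n \<Longrightarrow> c * real n powr (1 - p) \<le> A n" and p: "0 < p" "p < 1"
  shows "\<exists>D\<ge>0. \<forall>r\<in>{0<..1}. \<exists>k. \<forall>n\<ge>k. 1 \<le> n \<longrightarrow>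
    (\<integral>\<^sup>+ \<omega>. close_pairs (tree_prob n \<omega>) r \<partial>M) \<le> ennreal (D * r powr (1 / p))"
proof (intro exI[of _ "8 * exp (2 / (c * p)) / c"] conjI ballI)
  show "0 \<le> 8 * exp (2 / (c * p)) / c" using c by simp
  fix r :: real assume r: "r \<in> {0<..1}"
  define y where "y = r powr (- 1 / p)"
  have y1: "1 \<le> y"
    using powr_mono'[of "- 1 / p" 0 r] r p by (simp add: y_def)
  define k where "k = nat \<lfloor>y\<rfloor>"
  have k1: "1 \<le> k" unfolding k_def using y1 by (simp add: le_nat_iff le_floor_iff)
  have ky: "real k \<le> y" "y \<le> 2 * real k"
    using y1 k1 unfolding k_def by linarith+
  have yp: "r * y powr p = 1"
  proof -
    have "y powr p = r powr (- 1)"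
      using p by (simp only: y_def powr_powr) simp
    then show ?thesis using r by (simp add: powr_neg_one)
  qed
  have sum_A: "r * (\<Sum>m\<in>{1..<k}. 1 / A m) \<le> 1 / (c * p)"
  proof -
    have "1 / A m \<le> (1 / c) * real m powr (p - 1)" if "1 \<le> m" for m
    proof -
      have "0 < c * real m powr (1 - p)" using c that by simp
      then have "1 / A m \<le> 1 / (c * real m powr (1 - p))"
        using c(2)[OF that] by (intro divide_left_mono) auto
      also have "\<dots> = (1 / c) * real m powr (p - 1)"
        using powr_minus_divide[of "real m" "1 - p"] by simp
      finally show ?thesis .
    qed
    then have "(\<Sum>m\<in>{1..<k}. 1 / A m) \<le> (\<Sum>m\<in>{1..<k}. (1 / c) * real m powr (p - 1))"
      by (intro sum_mono) auto
    also have "\<dots> \<le> (\<Sum>m\<in>{1..k}. (1 / c) * real m powr (p - 1))"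
      using c by (intro sum_mono2) auto
    also have "\<dots> \<le> (1 / c) * (real k powr p / p)"
      using sum_powr_le[of p k] p c by (simp only: sum_distrib_left[symmetric]) (intro mult_left_mono, auto)
    also have "\<dots> \<le> (1 / c) * (y powr p / p)"
      using ky p c by (intro mult_left_mono divide_right_mono powr_mono2) auto
    finally have "r * (\<Sum>m\<in>{1..<k}. 1 / A m) \<le> r * ((1 / c) * (y powr p / p))"
      using r by (intro mult_left_mono) auto
    also have "\<dots> = (r * y powr p) / (c * p)"
      by simp
    finally show ?thesis unfolding yp .
  qed
  have Ak: "0 < A k" using k1 by (rule A_pos)
  have r_A: "r / A k \<le> 2 / c * r powr (1 / p)"
  proof -
    have "y powr (1 - p) \<le> (2 * real k) powr (1 - p)"
      using ky y1 p by (intro powr_mono2) auto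
    also have "\<dots> = 2 powr (1 - p) * real k powr (1 - p)"
      by (simp add: powr_mult)
    also have "\<dots> \<le> 2 powr 1 * real k powr (1 - p)"
      using p by (intro mult_right_mono powr_mono) auto
    finally have "c * y powr (1 - p) \<le> c * (2 powr 1 * real k powr (1 - p))"
      using c(1) by (intro mult_left_mono) auto
    also have "\<dots> \<le> 2 * A k"
      using c(2)[OF k1] by simp
    finally have "c * y powr (1 - p) \<le> 2 * A k" .
    then have "1 / A k \<le> 2 / (c * y powr (1 - p))"
      using Ak c(1) y1 by (simp add: divide_simps)
    then have "r * (1 / A k) \<le> r * (2 / (c * y powr (1 - p)))"
      using r by (intro mult_left_mono) auto
    also have "\<dots> = 2 / c * (r / y powr (1 - p))"
      by simp
    also have "r / y powr (1 - p) = r powr 1 / r powr ((- 1 / p) * (1 - p))"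
      using r by (simp add: y_def powr_powr)
    also have "\<dots> = r powr (1 / p)"
      using p by (subst powr_diff[symmetric]) (simp add: field_simps)
    finally show ?thesis by simp
  qed
  have "(\<integral>\<^sup>+ \<omega>. close_pairs (tree_prob n \<omega>) r \<partial>M) \<le> ennreal (8 * exp (2 / (c * p)) / c * r powr (1 / p))"
    if n: "k \<le> n" "1 \<le> n" for n
  proof -
    let ?X = "4 * r * exp (2 * r * (\<Sum>m\<in>{1..<k}. 1 / A m)) / A k"
    have An: "0 < A n" using n by (intro A_pos)
    have X: "0 \<le> ?X" using r Ak by simp
    have "(\<integral>\<^sup>+ \<omega>. close_pairs (tree_prob n \<omega>) r \<partial>M)
        = (\<integral>\<^sup>+ \<omega>. close_pairs (tree_length n \<omega>) r \<partial>M) / ennreal (A n) / ennreal (A n)"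
      by (simp add: close_pairs_tree_prob nn_integral_divide)
    also have "\<dots> \<le> ennreal ((A n)\<^sup>2 * ?X) / ennreal (A n) / ennreal (A n)"
      using mean_close_pairs_le[OF _ k1 n(1), of r] r by (intro divide_right_mono_ennreal) auto
    also have "\<dots> = ennreal ?X"
    proof -
      have "ennreal (b\<^sup>2 * y) / ennreal b / ennreal b = ennreal y" if "0 < b" "0 \<le> y" for b y :: real
        using that by (simp add: divide_ennreal power2_eq_square)
      then show ?thesis using An X by blast
    qed
    also have "?X = 4 * exp (2 * (r * (\<Sum>m\<in>{1..<k}. 1 / A m))) * (r / A k)"
      by (simp add: mult.assoc)
    also have "ennreal \<dots> \<le> ennreal (4 * exp (2 * (1 / (c * p))) * (2 / c * r powr (1 / p)))"
      using sum_A r_A r Ak by (intro ennreal_leI mult_mono mult_left_mono) auto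
    also have "4 * exp (2 * (1 / (c * p))) * (2 / c * r powr (1 / p)) = 8 * exp (2 / (c * p)) / c * r powr (1 / p)"
      by simp
    finally show ?thesis .
  qed
  then show "\<exists>k. \<forall>n\<ge>k. 1 \<le> n \<longrightarrow>
    (\<integral>\<^sup>+ \<omega>. close_pairs (tree_prob n \<omega>) r \<partial>M) \<le> ennreal (8 * exp (2 / (c * p)) / c * r powr (1 / p))"
    by blast
qed

lemma small_tail_sum:
  assumes summ: "(\<lambda>i. (a i)\<^sup>2 / A i) summable_on {1..}" and e: "0 < e"
  shows "\<exists>k\<ge>1. \<forall>n. (\<Sum>i\<in>{k<..n}. (a i)\<^sup>2 / A i) \<le> e"
proof -
  \<comment> \<open>The term of index \<open>0\<close> is a division by \<open>A 0 = 0\<close>, so it vanishes.\<close>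
  have "(\<lambda>i. (a i)\<^sup>2 / A i) summable_on UNIV"
    using summ by (rule summable_on_cong_neutral[THEN iffD1, rotated -1]) (auto simp: not_le)
  then have "summable (\<lambda>i. (a i)\<^sup>2 / A i)"
    by (rule summable_on_imp_summable)
  then obtain N where N: "\<And>m n. N \<le> m \<Longrightarrow> norm (\<Sum>i\<in>{m..<n}. (a i)\<^sup>2 / A i) < e"
    using e unfolding summable_Cauchy by meson
  have "(\<Sum>i\<in>{Suc N<..n}. (a i)\<^sup>2 / A i) \<le> e" for n
  proof -
    have "{Suc N<..n} = {Suc (Suc N)..<Suc n}" by auto
    then show ?thesis
      using N[of "Suc (Suc N)" "Suc n"] by (simp only:) auto
  qed
  then show ?thesis by (intro exI[of _ "Suc N"]) auto
qed

text \<open>A point of the box outside the compact set has some tail above \<open>(1 / 2) ^ j\<close>, so Markov's inequality loses a factor \<open>2 ^ j\<close>;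
  truncation levels \<open>k j\<close> with mean tails below \<open>\<eta> / 2 * (1 / 4) ^ j\<close> leave a geometric series.\<close>
lemma mean_outside_compact:
  assumes summ: "(\<lambda>i. (a i)\<^sup>2 / A i) summable_on {1..}" and \<eta>: "0 < \<eta>"
  shows "\<exists>k. \<forall>n\<ge>1. (\<integral>\<^sup>+ \<omega>. emeasure (tree_prob n \<omega>) (- tail_compact a k) \<partial>M) \<le> ennreal \<eta>"
proof -
  have "\<exists>k\<ge>1. \<forall>n. (\<Sum>i\<in>{k<..n}. (a i)\<^sup>2 / A i) \<le> \<eta> / 2 * (1 / 4) ^ j" for j :: nat
    by (rule small_tail_sum[OF summ]) (use \<eta> in simp)
  then obtain k :: "nat \<Rightarrow> nat" where k: "\<And>j. 1 \<le> k j"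
    "\<And>j n. (\<Sum>i\<in>{k j<..n}. (a i)\<^sup>2 / A i) \<le> \<eta> / 2 * (1 / 4) ^ j"
    by metis
  have [measurable]: "tail_compact a k \<in> sets borel"
    by (intro borel_closed compact_imp_closed compact_tail_compact)
  have [measurable]: "tail_norm m \<in> borel_measurable borel" for m
    by (intro borel_measurable_continuous_onI continuous_on_tail_norm)
  have "(\<integral>\<^sup>+ \<omega>. emeasure (tree_prob n \<omega>) (- tail_compact a k) \<partial>M) \<le> ennreal \<eta>" if n: "1 \<le> n" for n
  proof -
    have An: "0 < A n" using n by (rule A_pos)
    have pointwise: "indicator (- tail_compact a k) x \<le> (\<Sum>j. ennreal (2 ^ j) * ennreal (tail_norm (k j) x))"
      if x: "x \<in> box_l1 a n" for x
    proof (cases "x \<in> tail_compact a k")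
      case False
      have "0 \<le> coord x i \<and> coord x i \<le> a (Suc i)" for i
        using x a_nonneg[of "Suc i"] by (cases "i < n") (auto simp: box_l1_def)
      then obtain j where j: "(1 / 2) ^ j < tail_norm (k j) x"
        using False by (auto simp: tail_compact_def not_le)
      have "1 = ennreal (2 ^ j * (1 / 2) ^ j)"
        by (simp flip: power_mult_distrib)
      also have "\<dots> \<le> ennreal (2 ^ j * tail_norm (k j) x)"
        using j by (intro ennreal_leI mult_left_mono) auto
      also have "\<dots> = (\<Sum>i\<in>{j}. ennreal (2 ^ i) * ennreal (tail_norm (k i) x))"
        by (simp add: ennreal_mult)
      also have "\<dots> \<le> (\<Sum>j. ennreal (2 ^ j) * ennreal (tail_norm (k j) x))"
        by (rule sum_le_suminf) auto
      finally show ?thesis using False by simp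
    qed simp
    have "AE \<omega> in M. emeasure (tree_prob n \<omega>) (- tail_compact a k)
        \<le> (\<Sum>j. ennreal (2 ^ j) * (\<integral>\<^sup>+ x. ennreal (tail_norm (k j) x) \<partial>tree_length n \<omega>)) / ennreal (A n)"
      using AE_tree_length_box[of n]
    proof eventually_elim
      case (elim \<omega>)
      have "emeasure (tree_prob n \<omega>) (- tail_compact a k)
          = (\<integral>\<^sup>+ x. indicator (- tail_compact a k) x \<partial>tree_prob n \<omega>)"
        by (subst nn_integral_indicator) auto
      also have "\<dots> = (\<integral>\<^sup>+ x. indicator (- tail_compact a k) x \<partial>tree_length n \<omega>) / ennreal (A n)"
        by (rule nn_integral_tree_prob) simp
      also have "\<dots> \<le> (\<integral>\<^sup>+ x. (\<Sum>j. ennreal (2 ^ j) * ennreal (tail_norm (k j) x)) \<partial>tree_length n \<omega>) / ennreal (A n)"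
        using elim by (intro divide_right_mono_ennreal nn_integral_mono_AE) (auto intro: pointwise)
      also have "\<dots> = (\<Sum>j. ennreal (2 ^ j) * (\<integral>\<^sup>+ x. ennreal (tail_norm (k j) x) \<partial>tree_length n \<omega>)) / ennreal (A n)"
        by (subst nn_integral_suminf) (simp_all add: nn_integral_cmult)
      finally show ?case .
    qed
    then have "(\<integral>\<^sup>+ \<omega>. emeasure (tree_prob n \<omega>) (- tail_compact a k) \<partial>M)
        \<le> (\<integral>\<^sup>+ \<omega>. (\<Sum>j. ennreal (2 ^ j) * (\<integral>\<^sup>+ x. ennreal (tail_norm (k j) x) \<partial>tree_length n \<omega>)) / ennreal (A n) \<partial>M)"
      by (rule nn_integral_mono_AE)
    also have "\<dots> = (\<Sum>j. ennreal (2 ^ j) * (\<integral>\<^sup>+ \<omega>. \<integral>\<^sup>+ x. ennreal (tail_norm (k j) x) \<partial>tree_length n \<omega> \<partial>M)) / ennreal (A n)"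
      by (simp add: nn_integral_divide nn_integral_suminf nn_integral_cmult)
    also have "\<dots> \<le> (\<Sum>j. ennreal (A n * (\<eta> / 2) * (1 / 2) ^ j)) / ennreal (A n)"
    proof (intro divide_right_mono_ennreal suminf_le summableI)
      fix j
      have "(\<integral>\<^sup>+ \<omega>. \<integral>\<^sup>+ x. ennreal (tail_norm (k j) x) \<partial>tree_length n \<omega> \<partial>M)
          \<le> ennreal (A n * (\<Sum>i\<in>{k j<..n}. (a i)\<^sup>2 / A i))"
        by (rule mean_tail_norm_le[OF k(1)])
      also have "\<dots> \<le> ennreal (A n * (\<eta> / 2 * (1 / 4) ^ j))"
        using k(2) An by (intro ennreal_leI mult_left_mono) auto
      finally have "ennreal (2 ^ j) * (\<integral>\<^sup>+ \<omega>. \<integral>\<^sup>+ x. ennreal (tail_norm (k j) x) \<partial>tree_length n \<omega> \<partial>M)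
          \<le> ennreal (2 ^ j) * ennreal (A n * (\<eta> / 2 * (1 / 4) ^ j))"
        by (rule mult_left_mono) simp
      also have "\<dots> = ennreal (2 ^ j * (A n * (\<eta> / 2 * (1 / 4) ^ j)))"
        using An \<eta> by (intro ennreal_mult[symmetric]) auto
      also have "2 ^ j * (A n * (\<eta> / 2 * (1 / 4) ^ j)) = A n * (\<eta> / 2) * (2 * (1 / 4)) ^ j"
        by (simp only: power_mult_distrib mult.assoc mult.left_commute)
      finally show "ennreal (2 ^ j) * (\<integral>\<^sup>+ \<omega>. \<integral>\<^sup>+ x. ennreal (tail_norm (k j) x) \<partial>tree_length n \<omega> \<partial>M)
          \<le> ennreal (A n * (\<eta> / 2) * (1 / 2) ^ j)"
        by simp
    qed
    also have "(\<Sum>j. ennreal (A n * (\<eta> / 2) * (1 / 2) ^ j)) = ennreal (A n * \<eta>)"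
    proof (rule suminf_ennreal_eq)
      have "(\<lambda>j. A n * (\<eta> / 2) * (1 / 2) ^ j) sums (A n * (\<eta> / 2) * (1 / (1 - 1 / 2)))"
        by (intro sums_mult geometric_sums) simp
      then show "(\<lambda>j. A n * (\<eta> / 2) * (1 / 2) ^ j) sums (A n * \<eta>)" by simp
    qed (use An \<eta> in auto)
    also have "ennreal (A n * \<eta>) / ennreal (A n) = ennreal \<eta>"
      using An \<eta> by (simp add: divide_ennreal)
    finally show ?thesis .
  qed
  then show ?thesis by blast
qed

text \<open>Fatou's lemma combines tightness and bounded energy along a random subsequence of
  finite trees, which is all the energy method needs.\<close>
lemma AE_hausdorff_measure_neq_0:
  assumes c: "0 < c" "\<And>n. 1 \<le> n \<Longrightarrow> c * real n powr (1 - p) \<le> A n" and p: "0 < p" "p < 1"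
    and summ: "(\<lambda>i. (a i)\<^sup>2 / A i) summable_on {1..}"
    and s: "0 < s" "s < 1 / p"
  shows "AE \<omega> in M. \<forall>t. 0 < t \<and> t \<le> s \<longrightarrow> hausdorff_measure t (aggregation_tree a (\<lambda>i. U i \<omega>)) \<noteq> 0"
proof (rule AE_I_arbitrarily_small)
  fix \<delta> :: real assume \<delta>: "0 < \<delta>"
  obtain D where D: "0 \<le> D" "\<And>r. r \<in> {0<..1} \<Longrightarrow> \<exists>k. \<forall>n\<ge>k. 1 \<le> n \<longrightarrow>
    (\<integral>\<^sup>+ \<omega>. close_pairs (tree_prob n \<omega>) r \<partial>M) \<le> ennreal (D * r powr (1 / p))"
    using close_pairs_power_bound[OF c p] by blast
  have "\<exists>k. \<forall>n\<ge>k. 1 \<le> n \<longrightarrow>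
    (\<integral>\<^sup>+ \<omega>. close_pairs (tree_prob n \<omega>) ((1 / 2) ^ j) \<partial>M) \<le> ennreal (D * ((1 / 2) ^ j) powr (1 / p))" for j :: nat
    by (rule D(2)) (simp add: power_le_one)
  then obtain l where l: "\<And>j n. l j \<le> n \<Longrightarrow> 1 \<le> n \<Longrightarrow>
    (\<integral>\<^sup>+ \<omega>. close_pairs (tree_prob n \<omega>) ((1 / 2) ^ j) \<partial>M) \<le> ennreal (D * ((1 / 2) ^ j) powr (1 / p))"
    by metis
  \<comment> \<open>The scales resolved by the tree with \<open>Suc n\<close> branches. The index is shifted because the empty tree carries
    no probability measure.\<close>
  define J where "J n = {j. j \<le> n \<and> l j \<le> Suc n}" for n
  have J_fin: "finite (J n)" for n
    unfolding J_def by (rule finite_subset[of _ "{..n}"]) auto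
  have J_ev: "\<forall>\<^sub>F n in sequentially. j \<in> J n" for j
    using eventually_ge_at_top[of "max j (l j)"] by eventually_elim (simp add: J_def)
  define x where "x = (2::real) powr (s - 1 / p)"
  have x: "0 \<le> x" "x < 1"
    using s unfolding x_def by (simp_all add: powr_less_one)
  define B where "B = D / (1 - x)"
  have B: "0 \<le> B" using D x by (simp add: B_def)
  define W where "W n \<omega> = dyadic_energy s (J n) (tree_prob (Suc n) \<omega>)" for n \<omega>
  have W_meas [measurable]: "W n \<in> borel_measurable M" for n
    unfolding W_def [abs_def] dyadic_energy_def close_pairs_tree_prob by measurable
  have W_le: "(\<integral>\<^sup>+ \<omega>. W n \<omega> \<partial>M) \<le> ennreal B" for n
  proof -
    have [measurable]: "(\<lambda>\<omega>. close_pairs (tree_prob (Suc n) \<omega>) r) \<in> borel_measurable M" for r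
      unfolding close_pairs_tree_prob by measurable
    have "(\<integral>\<^sup>+ \<omega>. W n \<omega> \<partial>M)
        = (\<Sum>j\<in>J n. ennreal (2 powr (s * real j)) * (\<integral>\<^sup>+ \<omega>. close_pairs (tree_prob (Suc n) \<omega>) ((1 / 2) ^ j) \<partial>M))"
      unfolding W_def dyadic_energy_def by (simp add: nn_integral_sum nn_integral_cmult)
    also have "\<dots> \<le> (\<Sum>j\<in>J n. ennreal (2 powr (s * real j)) * ennreal (D * ((1 / 2) ^ j) powr (1 / p)))"
      by (intro sum_mono mult_left_mono l) (auto simp: J_def)
    also have "\<dots> = (\<Sum>j\<in>J n. ennreal (D * x ^ j))"
    proof (rule sum.cong[OF refl])
      fix j
      have "2 powr (s * real j) * ((1 / 2) ^ j) powr (1 / p) = x ^ j"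
      proof -
        have "((1 / 2 :: real) ^ j) powr (1 / p) = 2 powr (- (1 / p) * real j)"
          by (simp add: powr_powr powr_divide powr_minus_divide mult.commute flip: powr_realpow)
        then have "2 powr (s * real j) * ((1 / 2) ^ j) powr (1 / p) = 2 powr ((s - 1 / p) * real j)"
          by (simp add: left_diff_distrib flip: powr_add)
        also have "\<dots> = x ^ j"
          by (simp add: x_def powr_powr flip: powr_realpow)
        finally show ?thesis .
      qed
      then have "2 powr (s * real j) * (D * ((1 / 2) ^ j) powr (1 / p)) = D * x ^ j"
        by (metis mult.left_commute)
      then show "ennreal (2 powr (s * real j)) * ennreal (D * ((1 / 2) ^ j) powr (1 / p)) = ennreal (D * x ^ j)"
        using D(1) by (subst ennreal_mult[symmetric]) (simp, simp, simp only:)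
    qed
    also have "\<dots> = ennreal (\<Sum>j\<in>J n. D * x ^ j)"
      using D x by (intro sum_ennreal) simp
    also have "\<dots> \<le> ennreal B"
    proof (rule ennreal_leI)
      have sums: "(\<lambda>j. D * x ^ j) sums (D * (1 / (1 - x)))"
        using x by (intro sums_mult geometric_sums) simp
      have "(\<Sum>j\<in>J n. D * x ^ j) \<le> (\<Sum>j. D * x ^ j)"
        using D x J_fin by (intro sum_le_suminf sums_summable[OF sums]) auto
      then show "(\<Sum>j\<in>J n. D * x ^ j) \<le> B"
        using sums_unique[OF sums] by (simp add: B_def)
    qed
    finally show ?thesis .
  qed
  define \<eta> where "\<eta> = \<delta> / 4"
  define \<theta> where "\<theta> = \<delta> / (2 * (B + 1))"
  have \<eta>: "0 < \<eta>" and \<theta>: "0 < \<theta>" using \<delta> B by (simp_all add: \<eta>_def \<theta>_def)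
  obtain k where k: "\<And>n. 1 \<le> n \<Longrightarrow> (\<integral>\<^sup>+ \<omega>. emeasure (tree_prob n \<omega>) (- tail_compact a k) \<partial>M) \<le> ennreal \<eta>"
    using mean_outside_compact[OF summ \<eta>] by blast
  let ?K = "tail_compact a k"
  have K_meas [measurable]: "?K \<in> sets borel"
    by (intro borel_closed compact_imp_closed compact_tail_compact)
  have "emeasure (tree_prob n \<omega>) (- ?K) = (\<integral>\<^sup>+ x. indicator (- ?K) x \<partial>tree_length n \<omega>) / ennreal (A n)" for n \<omega>
    using nn_integral_tree_prob[of "indicator (- ?K)" \<omega> n] by simp
  then have K_tree [measurable]: "(\<lambda>\<omega>. emeasure (tree_prob n \<omega>) (- ?K)) \<in> borel_measurable M" for n
    by (simp only:) measurable
  \<comment> \<open>\<open>V n \<omega> < 1\<close> forces both that the compact set has mass at least \<open>1 / 2\<close> and that the energy is below \<open>1 / \<theta>\<close>.\<close>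
  define V where "V n \<omega> = 2 * emeasure (tree_prob (Suc n) \<omega>) (- ?K) + ennreal \<theta> * W n \<omega>" for n \<omega>
  have V_meas [measurable]: "V n \<in> borel_measurable M" for n
    unfolding V_def [abs_def] by measurable
  have "(\<integral>\<^sup>+ \<omega>. V n \<omega> \<partial>M) \<le> ennreal \<delta>" for n
  proof -
    have "(\<integral>\<^sup>+ \<omega>. V n \<omega> \<partial>M) = 2 * (\<integral>\<^sup>+ \<omega>. emeasure (tree_prob (Suc n) \<omega>) (- ?K) \<partial>M) + ennreal \<theta> * (\<integral>\<^sup>+ \<omega>. W n \<omega> \<partial>M)"
      unfolding V_def by (simp add: nn_integral_add nn_integral_cmult)
    also have "\<dots> \<le> 2 * ennreal \<eta> + ennreal \<theta> * ennreal B"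
      using k[of "Suc n"] W_le by (intro add_mono mult_left_mono) auto
    also have "\<dots> = ennreal (2 * \<eta> + \<theta> * B)"
      using \<eta> \<theta> B by (simp add: ennreal_mult flip: ennreal_numeral)
    also have "\<dots> \<le> ennreal \<delta>"
    proof (rule ennreal_leI)
      have "\<theta> * B \<le> \<theta> * (B + 1)"
        using \<theta> by (intro mult_left_mono) auto
      also have "\<dots> = \<delta> / 2" using B by (simp add: \<theta>_def field_simps)
      finally show "2 * \<eta> + \<theta> * B \<le> \<delta>" by (simp add: \<eta>_def)
    qed
    finally show ?thesis .
  qed
  then have "liminf (\<lambda>n. \<integral>\<^sup>+ \<omega>. V n \<omega> \<partial>M) \<le> ennreal \<delta>"
    by (intro Liminf_le) auto
  then have fatou: "(\<integral>\<^sup>+ \<omega>. liminf (\<lambda>n. V n \<omega>) \<partial>M) \<le> ennreal \<delta>"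
    using nn_integral_liminf[OF V_meas] by (rule order_trans[rotated])
  let ?N = "{\<omega>\<in>space M. 1 \<le> 1 * liminf (\<lambda>n. V n \<omega>)}"
  have "emeasure M ?N \<le> 1 * (\<integral>\<^sup>+ \<omega>. liminf (\<lambda>n. V n \<omega>) * indicator (space M) \<omega> \<partial>M)"
    by (rule nn_integral_Markov_inequality) auto
  also have "(\<integral>\<^sup>+ \<omega>. liminf (\<lambda>n. V n \<omega>) * indicator (space M) \<omega> \<partial>M) = (\<integral>\<^sup>+ \<omega>. liminf (\<lambda>n. V n \<omega>) \<partial>M)"
    by (intro nn_integral_cong) simp
  finally have N_small: "emeasure M ?N \<le> ennreal \<delta>"
    using fatou by simp
  have "\<forall>t. 0 < t \<and> t \<le> s \<longrightarrow> hausdorff_measure t (aggregation_tree a (\<lambda>i. U i \<omega>)) \<noteq> 0"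
    if \<omega>: "\<omega> \<in> space M - ?N" for \<omega>
  proof (intro allI impI)
    fix t assume t: "0 < t \<and> t \<le> s"
    have "liminf (\<lambda>n. V n \<omega>) < 1" using \<omega> by auto
    then have "\<not> (\<forall>\<^sub>F n in sequentially. 1 \<le> V n \<omega>)"
      using Liminf_bounded[of 1 "\<lambda>n. V n \<omega>" sequentially] by auto
    then have freq: "\<exists>\<^sub>F n in sequentially. V n \<omega> < 1"
      by (simp add: frequently_def not_less)
    show "hausdorff_measure t (aggregation_tree a (\<lambda>i. U i \<omega>)) \<noteq> 0"
    proof (rule hausdorff_measure_neq_0[where K = ?K and \<nu> = "\<lambda>n. tree_prob (Suc n) \<omega>" and J = J and s = s and R = "1 / \<theta>"])
      show "closed (aggregation_tree a (\<lambda>i. U i \<omega>))"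
        by (simp add: aggregation_tree_def)
      show "\<exists>\<^sub>F n in sequentially. 1 / 2 \<le> measure (tree_prob (Suc n) \<omega>) ?K
          \<and> dyadic_energy s (J n) (tree_prob (Suc n) \<omega>) \<le> ennreal (1 / \<theta>)"
        using freq
      proof (rule frequently_mono[rotated], intro allI impI conjI)
        fix n assume V: "V n \<omega> < 1"
        interpret \<nu>: prob_space "tree_prob (Suc n) \<omega>" by (rule prob_space_tree_prob) simp
        have "2 * emeasure (tree_prob (Suc n) \<omega>) (- ?K) < 1"
          using V unfolding V_def by (rule le_less_trans[rotated]) simp
        then have "ennreal (2 * measure (tree_prob (Suc n) \<omega>) (- ?K)) < ennreal 1"
          by (simp add: \<nu>.emeasure_eq_measure ennreal_mult flip: ennreal_numeral)
        then have "2 * measure (tree_prob (Suc n) \<omega>) (- ?K) < 1"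
          by (subst (asm) ennreal_less_iff) auto
        moreover have "measure (tree_prob (Suc n) \<omega>) (- ?K) = 1 - measure (tree_prob (Suc n) \<omega>) ?K"
          using \<nu>.prob_compl[of ?K] by (simp add: Compl_eq_Diff_UNIV uniform_on_tree_def)
        ultimately show "1 / 2 \<le> measure (tree_prob (Suc n) \<omega>) ?K" by simp
        have "ennreal \<theta> * W n \<omega> < 1"
          using V unfolding V_def by (rule le_less_trans[rotated]) simp
        then have "ennreal \<theta> * W n \<omega> \<le> ennreal \<theta> * ennreal (1 / \<theta>)"
          using \<theta> by (simp flip: ennreal_mult)
        then show "dyadic_energy s (J n) (tree_prob (Suc n) \<omega>) \<le> ennreal (1 / \<theta>)"
          using \<theta> unfolding W_def by (subst (asm) ennreal_mult_le_mult_iff) auto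
      qed
    qed (use t \<theta> J_fin J_ev AE_tree_prob prob_space_tree_prob compact_tail_compact in auto)
  qed
  then show "\<exists>N\<in>sets M. emeasure M N \<le> ennreal \<delta> \<and>
      (\<forall>\<omega>\<in>space M - N. \<forall>t. 0 < t \<and> t \<le> s \<longrightarrow> hausdorff_measure t (aggregation_tree a (\<lambda>i. U i \<omega>)) \<noteq> 0)"
    using N_small by (intro bexI[of _ ?N] conjI) auto
qed

end

section \<open>The dimension of the tree\<close>

theorem proposition13:
  fixes M :: "'w measure" and U :: "nat \<Rightarrow> 'w \<Rightarrow> l1"
    and a :: "nat \<Rightarrow> real" and \<alpha> :: real
  assumes "prob_space M"
    and "\<And>i. i \<ge> 1 \<Longrightarrow> a i > 0"
    and "uniform_gluing M a U"
    and "bounded (a ` {1..})"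
    and "(\<lambda>i. (a i)\<^sup>2 / partial_sum a i) summable_on {1..}"
    and "0 < \<alpha>" and "\<alpha> < 1"
    and "\<And>\<epsilon>. \<epsilon> > 0 \<Longrightarrow> \<forall>\<^sub>F n in sequentially. partial_sum a n \<ge> real n powr (1 - \<alpha> - \<epsilon>)"
  shows "AE \<omega> in M. hausdorff_dim (aggregation_tree a (\<lambda>i. U i \<omega>)) \<ge> ereal (1 / \<alpha>)"
proof -
  interpret aggregation M a U
    using assms(1-3) by (simp add: aggregation_def aggregation_axioms_def)
  let ?T = "\<lambda>\<omega>. aggregation_tree a (\<lambda>i. U i \<omega>)"
  have below: "AE \<omega> in M. \<forall>t. 0 < t \<and> t \<le> s \<longrightarrow> hausdorff_measure t (?T \<omega>) \<noteq> 0"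
    if s: "0 < s" "s < 1 / \<alpha>" for s
  proof -
    \<comment> \<open>Any \<open>p\<close> strictly between \<open>\<alpha>\<close> and \<open>1 / s\<close> leaves room for the loss \<open>\<epsilon> = p - \<alpha>\<close> in the growth of \<open>A\<close>.\<close>
    have "\<alpha> < min 1 (1 / s)"
      using s assms(6,7) by (simp add: field_simps)
    then obtain p where p: "\<alpha> < p" "p < 1" "p < 1 / s"
      using dense[of \<alpha> "min 1 (1 / s)"] by auto
    have "\<forall>\<^sub>F n in sequentially. real n powr (1 - \<alpha> - (p - \<alpha>)) \<le> A n"
      using p by (intro assms(8)) simp
    then obtain c where "0 < c" "\<And>n. 1 \<le> n \<Longrightarrow> c * real n powr (1 - p) \<le> A n"
      using power_lower_bound_A[of "1 - p"] p by auto
    then show ?thesis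
      using AE_hausdorff_measure_neq_0[of c p s] p s assms(5,6) by (simp add: field_simps)
  qed
  define s where "s m = (1 / \<alpha>) * (1 - inverse (real (Suc (Suc m))))" for m
  have s: "0 < s m" "s m < 1 / \<alpha>" for m
  proof -
    have "0 < inverse (real (Suc (Suc m)))" "inverse (real (Suc (Suc m))) < 1"
      by (simp_all add: inverse_less_1_iff)
    then show "0 < s m" "s m < 1 / \<alpha>"
      using assms(6) mult_strict_left_mono[of "1 - inverse (real (Suc (Suc m)))" 1 "1 / \<alpha>"]
      unfolding s_def by (auto intro: mult_pos_pos)
  qed
  have "AE \<omega> in M. \<forall>m t. 0 < t \<and> t \<le> s m \<longrightarrow> hausdorff_measure t (?T \<omega>) \<noteq> 0"
    using below[OF s] by (simp add: AE_all_countable)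
  then show ?thesis
  proof eventually_elim
    case (elim \<omega>)
    show ?case
      unfolding hausdorff_dim_def
    proof (rule Inf_greatest)
      fix y assume "y \<in> {ereal t |t. 0 < t \<and> hausdorff_measure t (?T \<omega>) = 0}"
      then obtain t where t: "y = ereal t" "0 < t" "hausdorff_measure t (?T \<omega>) = 0"
        by auto
      have "1 / \<alpha> \<le> t"
      proof (rule ccontr)
        assume "\<not> 1 / \<alpha> \<le> t"
        then have "0 < 1 - \<alpha> * t"
          using assms(6) by (simp add: field_simps)
        then obtain m where m: "inverse (real (Suc m)) < 1 - \<alpha> * t"
          using reals_Archimedean by blast
        have "inverse (real (Suc (Suc m))) \<le> inverse (real (Suc m))"
          by (intro le_imp_inverse_le) auto
        then have "\<alpha> * t \<le> 1 - inverse (real (Suc (Suc m)))"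
          using m by linarith
        then have "t \<le> s m"
          using assms(6) by (simp add: s_def pos_le_divide_eq mult.commute)
        then show False
          using elim t by blast
      qed
      then show "ereal (1 / \<alpha>) \<le> y"
        using t(1) by simp
    qed
  qed
qed

end
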